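(* For every closed bar formula $\phi$ of size $m$ and degree $k$ there is an extended regular nondeterministic nominal automaton (ERNNA) $A(\phi)$ whose degree is bounded exponentially in $k$ and polynomially in $m$, and whose number of orbits is bounded doubly exponentially in $k$ and singly exponentially in $m$, such that $L_\alpha(A(\phi))=[\![\phi]\!]$.
   Context: Nominal sets: fix a countably infinite set $\mathbb{A}$ of names and let $G$ be the group of finite permutations of $\mathbb{A}$. A nominal set is a set $X$ with a left $G$-action such that every $x\in X$ has a finite support, i.e. a finite $S\subseteq\mathbb{A}$ with $\pi\cdot x=x$ whenever $\pi$ fixes $S$ pointwise; $\mathrm{supp}(x)$ is the least finite support. Subsets, relations and functions are equivariant if invariant under the (pointwise) action. An orbit is a set $\{\pi\cdot x\mid\pi\in G\}$; $X$ is orbit-finite if it has finitely many orbits. For a nominal set $X$, the abstraction set $[\mathbb{A}]X$ is the quotient of $\mathbb{A}\times X$ by $(a,x)\sim(b,y)$ iff $(a\,c)\cdot x=(b\,c)\cdot y$ for some $c\in\mathbb{A}$ outside the supports of $a,x,b,y$; the class of $(a,x)$ is written $\langle a\rangle x$. Bar strings: $\overline{\mathbb{A}}=\mathbb{A}\cup\{|a\mid a\in\mathbb{A}\}$ (plain names and bar names), with $\pi\cdot a=\pi(a)$, $\pi\cdot|a=|\pi(a)$, acting letterwise on words $\overline{\mathbb{A}}^*$ (bar strings). $\alpha$-equivalence $\equiv_\alpha$ is the least equivalence on bar strings with $w|a v\equiv_\alpha w|b u$ whenever $\langle a\rangle v=\langle b\rangle u$ in $[\mathbb{A}]\overline{\mathbb{A}}^*$.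 An occurrence of a plain name $a$ is free if no $|a$ occurs to its left; $\mathrm{FN}(w)$ is the set of names with a free occurrence; for $S\subseteq\mathbb{A}$, $[S]=\{w\mid\mathrm{FN}(w)\subseteq S\}$. A bar language is a set of $\equiv_\alpha$-classes. Bar formulae: $\phi,\psi::=\epsilon\mid\neg\epsilon\mid\phi\wedge\psi\mid\phi\vee\psi\mid\Diamond_\sigma\phi\mid\Box_\sigma\phi\mid X\mid\mu X.\phi$ with $\sigma\in\overline{\mathbb{A}}$ and $X$ from a countably infinite set of fixpoint variables; in every $\mu X.\phi$ all free occurrences of $X$ in $\phi$ must lie within the scope of some modality. $\top:=\epsilon\vee\neg\epsilon$, $\bot:=\epsilon\wedge\neg\epsilon$. A name $a$ is free in $\phi$ if some $\Diamond_a$ or $\Box_a$ occurs in $\phi$ outside the scope of every $\Diamond_{|a},\Box_{|a}$; $\mathrm{FN}(\phi)$ is the set of free names, $\mathrm{BN}(\phi)$ the set of $a$ such that $|a$ occurs in $\phi$; the degree is $|\mathrm{FN}(\phi)\cup\mathrm{BN}(\phi)|$. $\phi$ is closed if it has no free fixpoint variables. The closure $\mathrm{cl}(\phi)$ is the least set containing $\phi$ closed under immediate subformulae and unfolding top-level fixpoints $\mu X.\psi\mapsto\psi[\mu X.\psi/X]$; the size of $\phi$ is $|\mathrm{cl}(\phi)|$. Fixpoint variables are implicitly annotated with the free names of their binding $\mu$-expression; $G$ renames names in modalities and annotations. Semantics: for a finite context $S\subseteq\mathbb{A}$ with $\mathrm{FN}(\phi)\subseteq S$ and $w\in[S]$: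 Booleans as usual; $S,w\models\epsilon$ iff $w$ is empty; $S,w\models\neg\epsilon$ iff $w$ nonempty; $S,w\models\mu X.\phi$ iff $S,w\models\phi[\mu X.\phi/X]$; $S,w\models\Diamond_a\phi$ iff $w=av$ with $S,v\models\phi$; $S,w\models\Box_a\phi$ iff $w=av$ implies $S,v\models\phi$; $S,w\models\Diamond_{|a}\phi$ iff there are a formula $\psi$, $v\in\overline{\mathbb{A}}^*$, $b\in\mathbb{A}$ with $w\equiv_\alpha|b v$, $\langle a\rangle\phi=\langle b\rangle\psi$ and $S\cup\{b\},v\models\psi$; $S,w\models\Box_{|a}\phi$ iff for all such $\psi,v,b$ with $w\equiv_\alpha|bv$ and $\langle a\rangle\phi=\langle b\rangle\psi$ we have $S\cup\{b\},v\models\psi$. For $\mathrm{FN}(\phi)=\emptyset$: $[\![\phi]\!]=\{w\in[\emptyset]\mid\emptyset,w\models\phi\}/{\equiv_\alpha}$. ERNNA: $A=(Q,\to,s,f)$ with $Q$ an orbit-finite nominal set, initial state $s$ with $\mathrm{supp}(s)=\emptyset$, equivariant $\to\subseteq Q\times(\overline{\mathbb{A}}\cup\{\epsilon\})\times Q$, equivariant $f:Q\to\{0,1,\top\}$, such that $q\xrightarrow{|a}q'$ and $\langle a\rangle q'=\langle b\rangle q''$ imply $q\xrightarrow{|b}q''$, and for each $q$ the sets $\{(a,q')\mid q\xrightarrow{a}q'\}$, $\{q'\mid q\xrightarrow{\epsilon}q'\}$, $\{\langle a\rangle q'\mid q\xrightarrow{|a}q'\}$ are finite; states with $f(q)=\top$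 have empty support and no outgoing transitions. The degree is the maximal $|\mathrm{supp}(q)|$, $q\in Q$. Extend $\to$ to words; $L_{pre}(A)=\{(w,f(q))\mid s\xrightarrow{w}q,\ f(q)\in\{1,\top\}\}$; $L_0(A)=[\emptyset]\cap(\{w\mid(w,1)\in L_{pre}(A)\}\cup\{vu\mid(v,\top)\in L_{pre}(A),u\in\overline{\mathbb{A}}^*\})$; $L_\alpha(A)=L_0(A)/{\equiv_\alpha}$. *)

theory Defs
  imports Main
begin

text \<open>Names are natural numbers (a countably infinite set). A finite permutation is a
bijection moving only finitely many names.\<close>

definition fperm :: "(nat \<Rightarrow> nat) \<Rightarrow> bool" where
  "fperm \<pi> \<longleftrightarrow> bij \<pi> \<and> finite {a. \<pi> a \<noteq> a}"

definition swp :: "nat \<Rightarrow> nat \<Rightarrow> nat \<Rightarrow> nat" where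
  "swp a b = (\<lambda>x. if x = a then b else if x = b then a else x)"

datatype bl = Plain nat | Bar nat

fun perm_bl :: "(nat \<Rightarrow> nat) \<Rightarrow> bl \<Rightarrow> bl" where
  "perm_bl \<pi> (Plain a) = Plain (\<pi> a)"
| "perm_bl \<pi> (Bar a) = Bar (\<pi> a)"

fun bl_name :: "bl \<Rightarrow> nat" where
  "bl_name (Plain a) = a"
| "bl_name (Bar a) = a"

definition perm_str :: "(nat \<Rightarrow> nat) \<Rightarrow> bl list \<Rightarrow> bl list" where
  "perm_str \<pi> w = map (perm_bl \<pi>) w"

definition names_str :: "bl list \<Rightarrow> nat set" where
  "names_str w = bl_name ` set w"

text \<open>Generic abstraction equality \<open>\<langle>a\<rangle>x = \<langle>b\<rangle>y\<close> for a nominal set given by an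
action and a support function.\<close>
definition abs_eq :: "((nat \<Rightarrow> nat) \<Rightarrow> 'x \<Rightarrow> 'x) \<Rightarrow> ('x \<Rightarrow> nat set) \<Rightarrow> nat \<Rightarrow> 'x \<Rightarrow> nat \<Rightarrow> 'x \<Rightarrow> bool" where
  "abs_eq act sp a x b y \<longleftrightarrow>
     (\<exists>c. c \<noteq> a \<and> c \<noteq> b \<and> c \<notin> sp x \<and> c \<notin> sp y \<and> act (swp a c) x = act (swp b c) y)"

fun fn_str :: "bl list \<Rightarrow> nat set" where
  "fn_str [] = {}"
| "fn_str (Plain a # w) = insert a (fn_str w)"
| "fn_str (Bar a # w) = fn_str w - {a}"

definition ctx_strs :: "nat set \<Rightarrow> bl list set" where
  "ctx_strs S = {w. fn_str w \<subseteq> S}"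

definition alpha_gen :: "(bl list \<times> bl list) set" where
  "alpha_gen = {(w @ Bar a # v, w @ Bar b # u) | w a v b u.
                  abs_eq perm_str names_str a v b u}"

definition alpha_eq :: "bl list \<Rightarrow> bl list \<Rightarrow> bool" where
  "alpha_eq w v \<longleftrightarrow> (w, v) \<in> (alpha_gen \<union> alpha_gen\<inverse>)\<^sup>*"

definition alpha_class :: "bl list \<Rightarrow> bl list set" where
  "alpha_class w = {v. alpha_eq w v}"

datatype fml = Eps | NEps | Conj fml fml | Disj fml fml
  | Dia bl fml | Box bl fml | FVar nat | Mu nat fml

fun perm_fml :: "(nat \<Rightarrow> nat) \<Rightarrow> fml \<Rightarrow> fml" where
  "perm_fml \<pi> Eps = Eps"
| "perm_fml \<pi> NEps = NEps"
| "perm_fml \<pi> (Conj \<phi> \<psi>) = Conj (perm_fml \<pi> \<phi>) (perm_fml \<pi> \<psi>)"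
| "perm_fml \<pi> (Disj \<phi> \<psi>) = Disj (perm_fml \<pi> \<phi>) (perm_fml \<pi> \<psi>)"
| "perm_fml \<pi> (Dia \<sigma> \<phi>) = Dia (perm_bl \<pi> \<sigma>) (perm_fml \<pi> \<phi>)"
| "perm_fml \<pi> (Box \<sigma> \<phi>) = Box (perm_bl \<pi> \<sigma>) (perm_fml \<pi> \<phi>)"
| "perm_fml \<pi> (FVar X) = FVar X"
| "perm_fml \<pi> (Mu X \<phi>) = Mu X (perm_fml \<pi> \<phi>)"

fun names_fml :: "fml \<Rightarrow> nat set" where
  "names_fml Eps = {}"
| "names_fml NEps = {}"
| "names_fml (Conj \<phi> \<psi>) = names_fml \<phi> \<union> names_fml \<psi>"
| "names_fml (Disj \<phi> \<psi>) = names_fml \<phi> \<union> names_fml \<psi>"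
| "names_fml (Dia \<sigma> \<phi>) = insert (bl_name \<sigma>) (names_fml \<phi>)"
| "names_fml (Box \<sigma> \<phi>) = insert (bl_name \<sigma>) (names_fml \<phi>)"
| "names_fml (FVar X) = {}"
| "names_fml (Mu X \<phi>) = names_fml \<phi>"

fun fn_fml :: "fml \<Rightarrow> nat set" where
  "fn_fml Eps = {}"
| "fn_fml NEps = {}"
| "fn_fml (Conj \<phi> \<psi>) = fn_fml \<phi> \<union> fn_fml \<psi>"
| "fn_fml (Disj \<phi> \<psi>) = fn_fml \<phi> \<union> fn_fml \<psi>"
| "fn_fml (Dia (Plain a) \<phi>) = insert a (fn_fml \<phi>)"
| "fn_fml (Dia (Bar a) \<phi>) = fn_fml \<phi> - {a}"
| "fn_fml (Box (Plain a) \<phi>) = insert a (fn_fml \<phi>)"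
| "fn_fml (Box (Bar a) \<phi>) = fn_fml \<phi> - {a}"
| "fn_fml (FVar X) = {}"
| "fn_fml (Mu X \<phi>) = fn_fml \<phi>"

fun bn_fml :: "fml \<Rightarrow> nat set" where
  "bn_fml Eps = {}"
| "bn_fml NEps = {}"
| "bn_fml (Conj \<phi> \<psi>) = bn_fml \<phi> \<union> bn_fml \<psi>"
| "bn_fml (Disj \<phi> \<psi>) = bn_fml \<phi> \<union> bn_fml \<psi>"
| "bn_fml (Dia (Plain a) \<phi>) = bn_fml \<phi>"
| "bn_fml (Dia (Bar a) \<phi>) = insert a (bn_fml \<phi>)"
| "bn_fml (Box (Plain a) \<phi>) = bn_fml \<phi>"
| "bn_fml (Box (Bar a) \<phi>) = insert a (bn_fml \<phi>)"
| "bn_fml (FVar X) = {}"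
| "bn_fml (Mu X \<phi>) = bn_fml \<phi>"

definition degree_fml :: "fml \<Rightarrow> nat" where
  "degree_fml \<phi> = card (fn_fml \<phi> \<union> bn_fml \<phi>)"

fun fv :: "fml \<Rightarrow> nat set" where
  "fv Eps = {}"
| "fv NEps = {}"
| "fv (Conj \<phi> \<psi>) = fv \<phi> \<union> fv \<psi>"
| "fv (Disj \<phi> \<psi>) = fv \<phi> \<union> fv \<psi>"
| "fv (Dia \<sigma> \<phi>) = fv \<phi>"
| "fv (Box \<sigma> \<phi>) = fv \<phi>"
| "fv (FVar X) = {X}"
| "fv (Mu X \<phi>) = fv \<phi> - {X}"

definition closed_fml :: "fml \<Rightarrow> bool" where
  "closed_fml \<phi> \<longleftrightarrow> fv \<phi> = {}"

fun unguarded :: "nat \<Rightarrow> fml \<Rightarrow> bool" where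
  "unguarded X Eps = False"
| "unguarded X NEps = False"
| "unguarded X (Conj \<phi> \<psi>) = (unguarded X \<phi> \<or> unguarded X \<psi>)"
| "unguarded X (Disj \<phi> \<psi>) = (unguarded X \<phi> \<or> unguarded X \<psi>)"
| "unguarded X (Dia \<sigma> \<phi>) = False"
| "unguarded X (Box \<sigma> \<phi>) = False"
| "unguarded X (FVar Y) = (X = Y)"
| "unguarded X (Mu Y \<phi>) = (X \<noteq> Y \<and> unguarded X \<phi>)"

fun bar_formula :: "fml \<Rightarrow> bool" where
  "bar_formula Eps = True"
| "bar_formula NEps = True"
| "bar_formula (Conj \<phi> \<psi>) = (bar_formula \<phi> \<and> bar_formula \<psi>)"
| "bar_formula (Disj \<phi> \<psi>) = (bar_formula \<phi> \<and> bar_formula \<psi>)"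
| "bar_formula (Dia \<sigma> \<phi>) = bar_formula \<phi>"
| "bar_formula (Box \<sigma> \<phi>) = bar_formula \<phi>"
| "bar_formula (FVar X) = True"
| "bar_formula (Mu X \<phi>) = (\<not> unguarded X \<phi> \<and> bar_formula \<phi>)"

text \<open>Substitution \<open>\<phi>[\<psi>/X]\<close> (used only with closed \<psi>, so no capture can occur).\<close>
fun subst :: "fml \<Rightarrow> nat \<Rightarrow> fml \<Rightarrow> fml" where
  "subst Eps X \<psi> = Eps"
| "subst NEps X \<psi> = NEps"
| "subst (Conj \<phi>1 \<phi>2) X \<psi> = Conj (subst \<phi>1 X \<psi>) (subst \<phi>2 X \<psi>)"
| "subst (Disj \<phi>1 \<phi>2) X \<psi> = Disj (subst \<phi>1 X \<psi>) (subst \<phi>2 X \<psi>)"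
| "subst (Dia \<sigma> \<phi>) X \<psi> = Dia \<sigma> (subst \<phi> X \<psi>)"
| "subst (Box \<sigma> \<phi>) X \<psi> = Box \<sigma> (subst \<phi> X \<psi>)"
| "subst (FVar Y) X \<psi> = (if Y = X then \<psi> else FVar Y)"
| "subst (Mu Y \<phi>) X \<psi> = (if Y = X then Mu Y \<phi> else Mu Y (subst \<phi> X \<psi>))"

inductive_set cl :: "fml \<Rightarrow> fml set" for \<phi> where
  self: "\<phi> \<in> cl \<phi>"
| conjL: "Conj \<psi>1 \<psi>2 \<in> cl \<phi> \<Longrightarrow> \<psi>1 \<in> cl \<phi>"
| conjR: "Conj \<psi>1 \<psi>2 \<in> cl \<phi> \<Longrightarrow> \<psi>2 \<in> cl \<phi>"
| disjL: "Disj \<psi>1 \<psi>2 \<in> cl \<phi> \<Longrightarrow> \<psi>1 \<in> cl \<phi>"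
| disjR: "Disj \<psi>1 \<psi>2 \<in> cl \<phi> \<Longrightarrow> \<psi>2 \<in> cl \<phi>"
| dia: "Dia \<sigma> \<psi> \<in> cl \<phi> \<Longrightarrow> \<psi> \<in> cl \<phi>"
| box: "Box \<sigma> \<psi> \<in> cl \<phi> \<Longrightarrow> \<psi> \<in> cl \<phi>"
| unfold: "Mu X \<psi> \<in> cl \<phi> \<Longrightarrow> subst \<psi> X (Mu X \<psi>) \<in> cl \<phi>"

definition size_fml :: "fml \<Rightarrow> nat" where
  "size_fml \<phi> = card (cl \<phi>)"

text \<open>The satisfaction relation \<open>S, w \<Turnstile> \<phi>\<close>, given by the defining clauses; the
fixpoint clause is read as the least solution (which for guarded formulae is the
unique one, since every unfolding is followed by a modality consuming a letter).\<close>
inductive sat :: "nat set \<Rightarrow> bl list \<Rightarrow> fml \<Rightarrow> bool" where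
  s_eps: "sat S [] Eps"
| s_neps: "w \<noteq> [] \<Longrightarrow> sat S w NEps"
| s_conj: "sat S w \<phi> \<Longrightarrow> sat S w \<psi> \<Longrightarrow> sat S w (Conj \<phi> \<psi>)"
| s_disjL: "sat S w \<phi> \<Longrightarrow> sat S w (Disj \<phi> \<psi>)"
| s_disjR: "sat S w \<psi> \<Longrightarrow> sat S w (Disj \<phi> \<psi>)"
| s_mu: "sat S w (subst \<phi> X (Mu X \<phi>)) \<Longrightarrow> sat S w (Mu X \<phi>)"
| s_dia: "sat S v \<phi> \<Longrightarrow> sat S (Plain a # v) (Dia (Plain a) \<phi>)"
| s_box: "(\<forall>v. w = Plain a # v \<longrightarrow> sat S v \<phi>) \<Longrightarrow> sat S w (Box (Plain a) \<phi>)"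
| s_diabar: "alpha_eq w (Bar b # v) \<Longrightarrow> abs_eq perm_fml names_fml a \<phi> b \<psi>
      \<Longrightarrow> sat (insert b S) v \<psi> \<Longrightarrow> sat S w (Dia (Bar a) \<phi>)"
| s_boxbar: "(\<forall>\<psi> v b. alpha_eq w (Bar b # v) \<and> abs_eq perm_fml names_fml a \<phi> b \<psi>
      \<longrightarrow> sat (insert b S) v \<psi>) \<Longrightarrow> sat S w (Box (Bar a) \<phi>)"

definition sem :: "fml \<Rightarrow> bl list set set" where
  "sem \<phi> = alpha_class ` {w. w \<in> ctx_strs {} \<and> sat {} w \<phi>}"

definition supports :: "((nat \<Rightarrow> nat) \<Rightarrow> 'q \<Rightarrow> 'q) \<Rightarrow> nat set \<Rightarrow> 'q \<Rightarrow> bool" where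
  "supports act S x \<longleftrightarrow> (\<forall>\<pi>. fperm \<pi> \<and> (\<forall>a\<in>S. \<pi> a = a) \<longrightarrow> act \<pi> x = x)"

definition supp :: "((nat \<Rightarrow> nat) \<Rightarrow> 'q \<Rightarrow> 'q) \<Rightarrow> 'q \<Rightarrow> nat set" where
  "supp act x = \<Inter> {S. finite S \<and> supports act S x}"

definition nominal_set :: "'q set \<Rightarrow> ((nat \<Rightarrow> nat) \<Rightarrow> 'q \<Rightarrow> 'q) \<Rightarrow> bool" where
  "nominal_set Q act \<longleftrightarrow>
     (\<forall>x\<in>Q. act id x = x)
   \<and> (\<forall>\<pi> \<sigma> x. fperm \<pi> \<and> fperm \<sigma> \<and> x \<in> Q \<longrightarrow> act (\<pi> \<circ> \<sigma>) x = act \<pi> (act \<sigma> x))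
   \<and> (\<forall>\<pi> x. fperm \<pi> \<and> x \<in> Q \<longrightarrow> act \<pi> x \<in> Q)
   \<and> (\<forall>x\<in>Q. \<exists>S. finite S \<and> supports act S x)"

definition orbit :: "((nat \<Rightarrow> nat) \<Rightarrow> 'q \<Rightarrow> 'q) \<Rightarrow> 'q \<Rightarrow> 'q set" where
  "orbit act x = {act \<pi> x | \<pi>. fperm \<pi>}"

definition orbits :: "'q set \<Rightarrow> ((nat \<Rightarrow> nat) \<Rightarrow> 'q \<Rightarrow> 'q) \<Rightarrow> 'q set set" where
  "orbits Q act = orbit act ` Q"

definition orbit_finite :: "'q set \<Rightarrow> ((nat \<Rightarrow> nat) \<Rightarrow> 'q \<Rightarrow> 'q) \<Rightarrow> bool" where
  "orbit_finite Q act \<longleftrightarrow> finite (orbits Q act)"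

datatype acc = Acc0 | Acc1 | AccTop

text \<open>Transitions are labelled by \<open>Some \<sigma>\<close> (a bar letter) or \<open>None\<close> (\<open>\<epsilon>\<close>).\<close>
record 'q ernna =
  Qs :: "'q set"
  pact :: "(nat \<Rightarrow> nat) \<Rightarrow> 'q \<Rightarrow> 'q"
  delta :: "('q \<times> bl option \<times> 'q) set"
  s0 :: 'q
  fa :: "'q \<Rightarrow> acc"

definition st_supp :: "'q ernna \<Rightarrow> 'q \<Rightarrow> nat set" where
  "st_supp A q = supp (pact A) q"

definition is_ernna :: "'q ernna \<Rightarrow> bool" where
  "is_ernna A \<longleftrightarrow>
     nominal_set (Qs A) (pact A) \<and> orbit_finite (Qs A) (pact A)
   \<and> s0 A \<in> Qs A \<and> st_supp A (s0 A) = {}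
   \<and> delta A \<subseteq> Qs A \<times> UNIV \<times> Qs A
   \<and> (\<forall>\<pi> q l q'. fperm \<pi> \<and> (q, l, q') \<in> delta A \<longrightarrow>
        (pact A \<pi> q, map_option (perm_bl \<pi>) l, pact A \<pi> q') \<in> delta A)
   \<and> (\<forall>\<pi> q. fperm \<pi> \<and> q \<in> Qs A \<longrightarrow> fa A (pact A \<pi> q) = fa A q)
   \<and> (\<forall>q a q' b q''. (q, Some (Bar a), q') \<in> delta A \<and> q'' \<in> Qs A
        \<and> abs_eq (pact A) (st_supp A) a q' b q''
        \<longrightarrow> (q, Some (Bar b), q'') \<in> delta A)
   \<and> (\<forall>q\<in>Qs A. finite {(a, q'). (q, Some (Plain a), q') \<in> delta A})
   \<and> (\<forall>q\<in>Qs A. finite {q'. (q, None, q') \<in> delta A})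
   \<and> (\<forall>q\<in>Qs A. finite
        {{(b, q''). q'' \<in> Qs A \<and> abs_eq (pact A) (st_supp A) a q' b q''} | a q'.
            (q, Some (Bar a), q') \<in> delta A})
   \<and> (\<forall>q\<in>Qs A. fa A q = AccTop \<longrightarrow>
        st_supp A q = {} \<and> (\<forall>l q'. (q, l, q') \<notin> delta A))"

definition degree_le :: "'q ernna \<Rightarrow> nat \<Rightarrow> bool" where
  "degree_le A d \<longleftrightarrow> (\<forall>q\<in>Qs A. card (st_supp A q) \<le> d)"

definition num_orbits :: "'q ernna \<Rightarrow> nat" where
  "num_orbits A = card (orbits (Qs A) (pact A))"

inductive run :: "'q ernna \<Rightarrow> 'q \<Rightarrow> bl list \<Rightarrow> 'q \<Rightarrow> bool" for A where
  run_nil: "q \<in> Qs A \<Longrightarrow> run A q [] q"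
| run_letter: "(q, Some \<sigma>, q') \<in> delta A \<Longrightarrow> run A q' w q'' \<Longrightarrow> run A q (\<sigma> # w) q''"
| run_eps: "(q, None, q') \<in> delta A \<Longrightarrow> run A q' w q'' \<Longrightarrow> run A q w q''"

definition L_pre :: "'q ernna \<Rightarrow> (bl list \<times> acc) set" where
  "L_pre A = {(w, fa A q) | w q. run A (s0 A) w q \<and> fa A q \<in> {Acc1, AccTop}}"

definition L_0 :: "'q ernna \<Rightarrow> bl list set" where
  "L_0 A = ctx_strs {} \<inter>
     ({w. (w, Acc1) \<in> L_pre A} \<union> {v @ u | v u. (v, AccTop) \<in> L_pre A})"

definition L_alpha :: "'q ernna \<Rightarrow> bl list set set" where
  "L_alpha A = alpha_class ` L_0 A"

end

theory Submission
  imports Defs "HOL-Library.FuncSet" "HOL-Library.Countable"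
begin

text \<open>The automaton is a Myhill--Nerode quotient. A word, viewed as the input still to be read, is
  identified with all words that satisfy the same renamed closure formulae and have the same free
  names. Satisfaction of these formulae by \<open>\<sigma> v\<close> only depends on their satisfaction by \<open>v\<close>, so the
  classes form an automaton whose runs check a guessed class backwards from the end of the input.
  Finite support comes from the following observation: a formula cannot look past a free plain name
  that it does not mention. Hence once some suffix of the input has shown more than \<open>k\<close> different
  free names, where \<open>k\<close> is the degree, the rest of the input is irrelevant and may be accepted
  wholesale; up to that point all suffixes have at most \<open>k + 1\<close> free names.\<close>

section \<open>Finite permutations and name abstraction\<close>

text \<open>Reading backwards, the automaton is deterministic: a state fixes the truth values of all
  relevant formulae at once, so conjunctions and boxes need no alternation, and the price is only
  the initial guess. The obstacle is the bar modality. It evaluates its argument under a fresh name,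
  that is, it asks for a renamed formula, which leads out of the closure; so truth of all renamings
  has to be recorded, an infinite family. Finiteness is recovered by counting: on words whose free
  names lie in \<open>S\<close>, a formula with at most \<open>k\<close> names can be moved by a
  permutation fixing \<open>S\<close> until its remaining names lie among \<open>k\<close> spare
  ones. With \<open>k + 1\<close> names in \<open>S\<close> this gives a pool of
  \<open>2 * k + 1\<close> names, and a state is determined by three flags, a subset of
  \<open>S\<close> and the truth values of at most \<open>m * (2 * k + 1) ^ k\<close> formulae,
  where \<open>m\<close> is the size. The outer exponential of the orbit bound comes from the truth
  values, the inner one from the renamings.\<close>

lemma fresh_name:
  assumes "finite A"
  obtains c :: nat where "c \<notin> A"
  using assms ex_new_if_finite[OF infinite_UNIV_nat] by metis

lemma fperm_inj: "fperm \<pi> \<Longrightarrow> inj \<pi>"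
  by (simp add: fperm_def bij_is_inj)

lemma fperm_id [simp]: "fperm id"
  by (simp add: fperm_def)

lemma fperm_comp [simp]:
  assumes "fperm \<pi>" "fperm \<sigma>"
  shows "fperm (\<pi> \<circ> \<sigma>)"
proof -
  have "{a. (\<pi> \<circ> \<sigma>) a \<noteq> a} \<subseteq> {a. \<pi> a \<noteq> a} \<union> {a. \<sigma> a \<noteq> a}"
    by auto
  then show ?thesis
    using assms unfolding fperm_def by (meson bij_comp finite_UnI finite_subset)
qed

lemma fperm_inv [simp]:
  assumes "fperm \<pi>"
  shows "fperm (inv \<pi>)"
proof -
  have "{a. inv \<pi> a \<noteq> a} = {a. \<pi> a \<noteq> a}"
    using assms unfolding fperm_def by (metis bij_inv_eq_iff)
  then show ?thesis
    using assms by (simp add: fperm_def bij_imp_bij_inv)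
qed

lemma inv_comp_fperm [simp]: "fperm \<pi> \<Longrightarrow> inv \<pi> \<circ> \<pi> = id"
  by (simp add: fperm_inj)

lemma comp_inv_fperm [simp]: "fperm \<pi> \<Longrightarrow> \<pi> \<circ> inv \<pi> = id"
  by (metis bij_is_surj fperm_def surj_iff)

lemma swp_left [simp]: "swp a b a = b"
  and swp_right [simp]: "swp a b b = a"
  and swp_other [simp]: "x \<noteq> a \<Longrightarrow> x \<noteq> b \<Longrightarrow> swp a b x = x"
  by (auto simp: swp_def)

lemma swp_same [simp]: "swp a a = id"
  by (auto simp: swp_def)

lemma swp_comp_swp [simp]: "swp a b \<circ> swp a b = id"
  by (auto simp: swp_def)

lemma fperm_swp [simp]: "fperm (swp a b)"
proof -
  have "finite {x. swp a b x \<noteq> x}"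
    by (rule finite_subset[of _ "{a, b}"]) (auto simp: swp_def)
  then show ?thesis
    unfolding fperm_def by (metis o_bij swp_comp_swp)
qed

lemma comp_swp: "fperm \<pi> \<Longrightarrow> \<pi> \<circ> swp a b = swp (\<pi> a) (\<pi> b) \<circ> \<pi>"
  by (auto simp: swp_def fun_eq_iff dest: fperm_inj injD)

text \<open>Needed for counting, where names are moved into a fixed finite pool. Each new value is
  corrected by one swap, which disturbs no earlier value because \<open>f\<close> and the
  permutation are injective.\<close>

lemma fperm_extends_inj_on:
  assumes "finite A" "inj_on f A"
  obtains \<pi> where "fperm \<pi>" "\<And>a. a \<in> A \<Longrightarrow> \<pi> a = f a"
proof -
  have "\<exists>\<pi>. fperm \<pi> \<and> (\<forall>a\<in>A. \<pi> a = f a)"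
    using assms
  proof (induction A rule: finite_induct)
    case empty
    then show ?case by (auto intro: fperm_id)
  next
    case (insert a A)
    then obtain \<pi> where \<pi>: "fperm \<pi>" "\<forall>x\<in>A. \<pi> x = f x"
      by auto
    have "\<forall>x\<in>insert a A. (swp (\<pi> a) (f a) \<circ> \<pi>) x = f x"
    proof
      fix x assume x: "x \<in> insert a A"
      show "(swp (\<pi> a) (f a) \<circ> \<pi>) x = f x"
      proof (cases "x = a")
        case False
        with x have "x \<in> A" by simp
        moreover have "f x \<noteq> f a"
          using insert.hyps insert.prems \<open>x \<in> A\<close> by (auto simp: inj_on_def)
        moreover have "\<pi> x \<noteq> \<pi> a"
          using False \<pi>(1) by (meson fperm_inj injD)
        ultimately show ?thesis using \<pi>(2) by auto
      qed simp
    qed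
    then show ?case using \<pi>(1) fperm_comp fperm_swp by blast
  qed
  then show ?thesis using that by blast
qed

text \<open>The pattern shared by bar strings, formulae and automaton states. A carrier is fixed
  because the states are only a subset of their type.\<close>

locale name_action =
  fixes Q :: "'x set" and act :: "(nat \<Rightarrow> nat) \<Rightarrow> 'x \<Rightarrow> 'x" and sp :: "'x \<Rightarrow> nat set"
  assumes act_id: "x \<in> Q \<Longrightarrow> act id x = x"
    and act_comp: "x \<in> Q \<Longrightarrow> fperm \<pi> \<Longrightarrow> fperm \<sigma> \<Longrightarrow> act \<pi> (act \<sigma> x) = act (\<pi> \<circ> \<sigma>) x"
    and act_closed: "x \<in> Q \<Longrightarrow> fperm \<pi> \<Longrightarrow> act \<pi> x \<in> Q"
    and act_cong: "x \<in> Q \<Longrightarrow> fperm \<pi> \<Longrightarrow> fperm \<sigma> \<Longrightarrow> (\<And>a. a \<in> sp x \<Longrightarrow> \<pi> a = \<sigma> a) \<Longrightarrow>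
      act \<pi> x = act \<sigma> x"
    and sp_act: "x \<in> Q \<Longrightarrow> fperm \<pi> \<Longrightarrow> sp (act \<pi> x) = \<pi> ` sp x"
    and finite_sp: "x \<in> Q \<Longrightarrow> finite (sp x)"
begin

text \<open>Undoing the swap on the right removes the witness \<open>c\<close>: \<open>y\<close> is
  the image of \<open>x\<close> under \<open>swp b c \<circ> swp a c\<close>. For distinct
  \<open>a\<close> and \<open>b\<close> this map sends \<open>b\<close> to \<open>c\<close>, so
  \<open>b\<close> cannot lie in \<open>sp x\<close>, and on \<open>sp x\<close> it agrees with
  \<open>swp a b\<close>.\<close>

lemma abs_eq_iff:
  assumes "x \<in> Q" "y \<in> Q"
  shows "abs_eq act sp a x b y \<longleftrightarrow>
    (a = b \<and> x = y) \<or> (a \<noteq> b \<and> b \<notin> sp x \<and> y = act (swp a b) x)"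
proof
  assume "abs_eq act sp a x b y"
  then obtain c where c: "c \<noteq> a" "c \<noteq> b" "c \<notin> sp x" "c \<notin> sp y"
    and eq: "act (swp a c) x = act (swp b c) y"
    by (auto simp: abs_eq_def)
  have "y = act (swp b c) (act (swp b c) y)"
    by (simp only: act_comp[OF assms(2) fperm_swp fperm_swp] swp_comp_swp act_id[OF assms(2)])
  also have "\<dots> = act (swp b c \<circ> swp a c) x"
    by (simp only: eq[symmetric] act_comp[OF assms(1) fperm_swp fperm_swp])
  finally have y: "y = act (swp b c \<circ> swp a c) x" .
  show "(a = b \<and> x = y) \<or> (a \<noteq> b \<and> b \<notin> sp x \<and> y = act (swp a b) x)"
  proof (cases "a = b")
    case True
    then show ?thesis
      using y by (simp only: swp_comp_swp act_id[OF assms(1)] simp_thms)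
  next
    case False
    have sp_y: "sp y = (swp b c \<circ> swp a c) ` sp x"
      unfolding y by (rule sp_act[OF assms(1)]) simp
    have "b \<notin> sp x"
    proof
      assume "b \<in> sp x"
      then have "(swp b c \<circ> swp a c) b \<in> sp y" using sp_y by blast
      then show False using False c by simp
    qed
    moreover have "y = act (swp a b) x"
      unfolding y
    proof (rule act_cong[OF assms(1)])
      fix d assume "d \<in> sp x"
      then show "(swp b c \<circ> swp a c) d = swp a b d"
        using \<open>b \<notin> sp x\<close> c by (auto simp: swp_def)
    qed simp_all
    ultimately show ?thesis using False by simp
  qed
next
  assume rhs: "(a = b \<and> x = y) \<or> (a \<noteq> b \<and> b \<notin> sp x \<and> y = act (swp a b) x)"
  have "finite ({a, b} \<union> sp x \<union> sp y)"
    using assms by (simp add: finite_sp)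
  then obtain c where c: "c \<notin> {a, b} \<union> sp x \<union> sp y"
    by (rule fresh_name)
  have "act (swp a c) x = act (swp b c) y"
    using rhs
  proof
    assume *: "a \<noteq> b \<and> b \<notin> sp x \<and> y = act (swp a b) x"
    have "act (swp a c) x = act (swp b c \<circ> swp a b) x"
    proof (rule act_cong[OF assms(1)])
      fix d assume "d \<in> sp x"
      then show "swp a c d = (swp b c \<circ> swp a b) d"
        using * c by (auto simp: swp_def)
    qed simp_all
    then show ?thesis
      using * by (simp only: act_comp[OF assms(1) fperm_swp fperm_swp])
  qed simp
  then show "abs_eq act sp a x b y"
    using c by (auto simp: abs_eq_def)
qed

text \<open>An abstraction may be represented with any prescribed fresh name. This later makes the
  bar successors of a state countable through representatives with one fixed bound name.\<close>

lemma abs_eq_rename: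
  assumes "x \<in> Q" "y \<in> Q" "c \<noteq> a" "c \<notin> sp x"
  shows "abs_eq act sp a x b y \<longleftrightarrow> abs_eq act sp c (act (swp a c) x) b y"
proof -
  have cl: "act (swp a c) x \<in> Q" and sp: "sp (act (swp a c) x) = swp a c ` sp x"
    using assms(1) by (simp_all only: act_closed sp_act fperm_swp)
  have comp: "act (swp c b) (act (swp a c) x) = act (swp c b \<circ> swp a c) x"
    using assms(1) by (simp only: act_comp fperm_swp)
  note iff = abs_eq_iff[OF assms(1,2)] abs_eq_iff[OF cl assms(2)] sp comp
  consider "b = c" | "b = a" | "b \<noteq> c" "b \<noteq> a" by blast
  then show ?thesis
  proof cases
    case 1
    then show ?thesis using assms(3,4) unfolding iff by metis
  next
    case 2
    have "swp c a \<circ> swp a c = id"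
      by (auto simp: swp_def)
    then have "act (swp c a \<circ> swp a c) x = x"
      by (simp only: act_id[OF assms(1)])
    moreover have "a \<notin> swp a c ` sp x"
      using assms(3,4) by (auto simp: swp_def split: if_splits)
    ultimately show ?thesis using assms(3) unfolding iff unfolding 2 by metis
  next
    case 3
    have "b \<in> swp a c ` sp x \<longleftrightarrow> b \<in> sp x"
      using 3 by (auto simp: swp_def image_iff split: if_splits)
    moreover have "act (swp c b \<circ> swp a c) x = act (swp a b) x" if "b \<notin> sp x"
    proof (rule act_cong[OF assms(1)])
      fix d assume "d \<in> sp x"
      then show "(swp c b \<circ> swp a c) d = swp a b d"
        using that assms(4) by (auto simp: swp_def)
    qed (intro fperm_comp fperm_swp)+
    ultimately show ?thesis using 3 unfolding iff by metis
  qed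
qed

end

section \<open>Bar strings up to \<open>\<alpha>\<close>-equivalence\<close>

lemma perm_str_simps [simp]:
  "perm_str \<pi> [] = []"
  "perm_str \<pi> (l # w) = perm_bl \<pi> l # perm_str \<pi> w"
  "perm_str \<pi> (w @ v) = perm_str \<pi> w @ perm_str \<pi> v"
  by (simp_all add: perm_str_def)

lemma perm_str_eq_Nil [simp]: "perm_str \<pi> w = [] \<longleftrightarrow> w = []"
  by (simp add: perm_str_def)

lemma length_perm_str [simp]: "length (perm_str \<pi> w) = length w"
  by (simp add: perm_str_def)

lemma perm_bl_id [simp]: "perm_bl id l = l"
  by (cases l) auto

lemma perm_bl_comp [simp]: "perm_bl \<pi> (perm_bl \<sigma> l) = perm_bl (\<pi> \<circ> \<sigma>) l"
  by (cases l) auto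

lemma bl_name_perm [simp]: "bl_name (perm_bl \<pi> l) = \<pi> (bl_name l)"
  by (cases l) auto

lemma perm_bl_cong: "\<pi> (bl_name l) = \<sigma> (bl_name l) \<Longrightarrow> perm_bl \<pi> l = perm_bl \<sigma> l"
  by (cases l) auto

lemma perm_str_id [simp]: "perm_str id w = w"
  by (simp add: perm_str_def map_idI)

lemma perm_str_comp [simp]: "perm_str \<pi> (perm_str \<sigma> w) = perm_str (\<pi> \<circ> \<sigma>) w"
  by (simp add: perm_str_def)

lemma names_str_simps [simp]:
  "names_str [] = {}"
  "names_str (l # w) = insert (bl_name l) (names_str w)"
  by (simp_all add: names_str_def)

lemma finite_names_str [simp]: "finite (names_str w)"
  by (simp add: names_str_def)

lemma names_str_perm [simp]: "names_str (perm_str \<pi> w) = \<pi> ` names_str w"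
  by (induction w) auto

lemma perm_str_cong: "(\<And>a. a \<in> names_str w \<Longrightarrow> \<pi> a = \<sigma> a) \<Longrightarrow> perm_str \<pi> w = perm_str \<sigma> w"
  by (induction w) (auto intro: perm_bl_cong)

interpretation str: name_action UNIV perm_str names_str
  by unfold_locales (auto intro: perm_str_cong)

lemma fn_str_names: "fn_str w \<subseteq> names_str w"
  by (induction w rule: fn_str.induct) auto

lemma finite_fn_str [simp]: "finite (fn_str w)"
  using fn_str_names finite_names_str finite_subset by blast

lemma fn_str_perm: "inj \<pi> \<Longrightarrow> fn_str (perm_str \<pi> w) = \<pi> ` fn_str w"
  by (induction w rule: fn_str.induct) (simp_all add: image_set_diff)

lemma fn_str_Cons_perm: "inj \<pi> \<Longrightarrow> fn_str (perm_bl \<pi> l # perm_str \<pi> w) = \<pi> ` fn_str (l # w)"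
  using fn_str_perm[of \<pi> "l # w"] by simp

lemma fn_str_Cons_cong: "fn_str v = fn_str w \<Longrightarrow> fn_str (l # v) = fn_str (l # w)"
  by (cases l) auto

lemma fn_str_append_mono: "fn_str w \<subseteq> fn_str (w @ u)"
  by (induction w rule: fn_str.induct) auto

lemma fn_str_Bar_swp:
  assumes "b \<notin> fn_str (Bar a # v)"
  shows "fn_str (Bar b # perm_str (swp a b) v) = fn_str (Bar a # v)"
proof -
  have "fn_str (perm_str (swp a b) v) = swp a b ` fn_str v"
    by (simp add: fn_str_perm fperm_inj)
  then show ?thesis
    using assms by (auto simp: swp_def image_iff split: if_splits)
qed

section \<open>Inversion and cancellation laws for alpha-equivalence\<close>

lemma alpha_gen_sym: "(x, y) \<in> alpha_gen \<Longrightarrow> (y, x) \<in> alpha_gen"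
  unfolding alpha_gen_def abs_eq_def by auto metis

lemma alpha_eq_alt: "alpha_eq x y \<longleftrightarrow> (x, y) \<in> alpha_gen\<^sup>*"
proof -
  have "alpha_gen \<union> alpha_gen\<inverse> = alpha_gen"
    by (auto intro: alpha_gen_sym)
  then show ?thesis by (simp add: alpha_eq_def)
qed

lemma alpha_eq_refl [simp]: "alpha_eq w w"
  by (simp add: alpha_eq_alt)

lemma alpha_eq_trans [trans]: "alpha_eq x y \<Longrightarrow> alpha_eq y z \<Longrightarrow> alpha_eq x z"
  unfolding alpha_eq_alt by (rule rtrancl_trans)

lemma alpha_eq_sym: "alpha_eq x y \<Longrightarrow> alpha_eq y x"
  unfolding alpha_eq_alt
  by (meson alpha_gen_sym symD symI sym_rtrancl)

text \<open>The generators rewrite below an arbitrary prefix; splitting on whether it is empty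
  yields a head rule and a congruence rule, the form suited to induction over words.\<close>

lemma alpha_gen_cases:
  assumes "(x, y) \<in> alpha_gen"
  obtains (Bar) a v b u where "x = Bar a # v" "y = Bar b # u" "abs_eq perm_str names_str a v b u"
  | (Cons) l v u where "x = l # v" "y = l # u" "(v, u) \<in> alpha_gen"
proof -
  obtain w a v b u where *: "x = w @ Bar a # v" "y = w @ Bar b # u"
    "abs_eq perm_str names_str a v b u"
    using assms by (auto simp: alpha_gen_def)
  show thesis
  proof (cases w)
    case Nil
    with * show ?thesis by (auto intro: Bar)
  next
    case (Cons l w')
    moreover have "(w' @ Bar a # v, w' @ Bar b # u) \<in> alpha_gen"
      using *(3) unfolding alpha_gen_def by blast
    ultimately show ?thesis
      using *(1,2) that(2)[of l "w' @ Bar a # v" "w' @ Bar b # u"] by simp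
  qed
qed

lemma alpha_gen_Nil [simp]: "([], y) \<notin> alpha_gen"
  by (auto simp: alpha_gen_def)

lemma alpha_gen_Plain:
  assumes "(Plain a # v, y) \<in> alpha_gen"
  obtains u where "y = Plain a # u" "(v, u) \<in> alpha_gen"
  using assms by (cases rule: alpha_gen_cases) auto

lemma alpha_gen_Cons:
  assumes "(v, u) \<in> alpha_gen"
  shows "(l # v, l # u) \<in> alpha_gen"
proof -
  obtain w a v' b u' where "v = w @ Bar a # v'" "u = w @ Bar b # u'"
    "abs_eq perm_str names_str a v' b u'"
    using assms by (auto simp: alpha_gen_def)
  then have "l # v = (l # w) @ Bar a # v'" "l # u = (l # w) @ Bar b # u'"
    "abs_eq perm_str names_str a v' b u'" by auto
  then show ?thesis unfolding alpha_gen_def by blast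
qed

lemma alpha_gen_Bar: "abs_eq perm_str names_str a v b u \<Longrightarrow> (Bar a # v, Bar b # u) \<in> alpha_gen"
  unfolding alpha_gen_def by (metis (mono_tags, lifting) append_Nil mem_Collect_eq)

lemma alpha_eq_Cons: "alpha_eq v u \<Longrightarrow> alpha_eq (l # v) (l # u)"
  unfolding alpha_eq_alt
  by (induction rule: rtrancl_induct) (simp, meson alpha_gen_Cons rtrancl_into_rtrancl)

lemma alpha_eq_Bar_fresh:
  assumes "c \<notin> names_str v"
  shows "alpha_eq (Bar a # v) (Bar c # perm_str (swp a c) v)"
proof -
  have "abs_eq perm_str names_str a v c (perm_str (swp a c) v)"
    using assms by (auto simp: str.abs_eq_iff)
  then show ?thesis unfolding alpha_eq_alt by (blast intro: alpha_gen_Bar)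
qed

text \<open>At a binder both images of the bound name are moved to one fresh \<open>c\<close>, after
  which the composed renamings agree on the bound name as well; hence the induction ranges over all
  renamings. This is why every alpha-invariant notion depends on the free names only.\<close>

lemma alpha_eq_perm_cong:
  assumes "fperm \<pi>" "fperm \<sigma>" "\<And>a. a \<in> fn_str v \<Longrightarrow> \<pi> a = \<sigma> a"
  shows "alpha_eq (perm_str \<pi> v) (perm_str \<sigma> v)"
  using assms
proof (induction v arbitrary: \<pi> \<sigma>)
  case (Cons l v)
  show ?case
  proof (cases l)
    case (Plain a)
    then show ?thesis using Cons by (auto intro: alpha_eq_Cons)
  next
    case l: (Bar a)
    have "finite ({\<pi> a, \<sigma> a} \<union> \<pi> ` names_str v \<union> \<sigma> ` names_str v)" by simp
    then obtain c where c: "c \<notin> {\<pi> a, \<sigma> a} \<union> \<pi> ` names_str v \<union> \<sigma> ` names_str v"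
      by (rule fresh_name)
    have "alpha_eq (perm_str (swp (\<pi> a) c \<circ> \<pi>) v) (perm_str (swp (\<sigma> a) c \<circ> \<sigma>) v)"
    proof (rule Cons.IH)
      fix x assume x: "x \<in> fn_str v"
      show "(swp (\<pi> a) c \<circ> \<pi>) x = (swp (\<sigma> a) c \<circ> \<sigma>) x"
      proof (cases "x = a")
        case False
        then have "\<pi> x \<noteq> \<pi> a" "\<sigma> x \<noteq> \<sigma> a"
          using Cons.prems by (meson fperm_inj injD)+
        moreover have "\<pi> x \<noteq> c" "\<sigma> x \<noteq> c" using c x fn_str_names by blast+
        moreover have "\<pi> x = \<sigma> x" using Cons.prems(3) x l False by simp
        ultimately show ?thesis by simp
      qed simp
    qed (intro fperm_comp fperm_swp Cons.prems)+
    then have "alpha_eq (Bar c # perm_str (swp (\<pi> a) c) (perm_str \<pi> v))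
      (Bar c # perm_str (swp (\<sigma> a) c) (perm_str \<sigma> v))"
      by (simp add: alpha_eq_Cons)
    moreover have "alpha_eq (Bar (\<pi> a) # perm_str \<pi> v) (Bar c # perm_str (swp (\<pi> a) c) (perm_str \<pi> v))"
      "alpha_eq (Bar (\<sigma> a) # perm_str \<sigma> v) (Bar c # perm_str (swp (\<sigma> a) c) (perm_str \<sigma> v))"
      by (rule alpha_eq_Bar_fresh, use c in simp)+
    ultimately show ?thesis
      unfolding l by simp (meson alpha_eq_sym alpha_eq_trans)
  qed
qed simp

text \<open>A single generator requires \<open>b\<close> to be absent from \<open>v\<close>
  altogether, whereas here \<open>b\<close> may still occur bound; the detour through a completely
  fresh \<open>c\<close> closes the gap.\<close>

lemma alpha_eq_Bar_swp:
  assumes "b \<notin> fn_str (Bar a # v)"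
  shows "alpha_eq (Bar a # v) (Bar b # perm_str (swp a b) v)"
proof -
  have "finite ({a, b} \<union> names_str v)" by simp
  then obtain c where c: "c \<notin> {a, b} \<union> names_str v"
    by (rule fresh_name)
  have "alpha_eq (perm_str (swp a c) v) (perm_str (swp b c \<circ> swp a b) v)"
  proof (rule alpha_eq_perm_cong)
    fix x assume "x \<in> fn_str v"
    then show "swp a c x = (swp b c \<circ> swp a b) x"
      using assms c fn_str_names[of v] by (auto simp: swp_def)
  qed auto
  then have "alpha_eq (Bar c # perm_str (swp a c) v) (Bar c # perm_str (swp b c) (perm_str (swp a b) v))"
    by (simp add: alpha_eq_Cons)
  moreover have "alpha_eq (Bar a # v) (Bar c # perm_str (swp a c) v)"
    using c by (simp add: alpha_eq_Bar_fresh)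
  moreover have "c \<notin> swp a b ` names_str v"
    using c by (auto simp: swp_def)
  then have "alpha_eq (Bar b # perm_str (swp a b) v) (Bar c # perm_str (swp b c) (perm_str (swp a b) v))"
    by (intro alpha_eq_Bar_fresh) simp
  ultimately show ?thesis by (meson alpha_eq_sym alpha_eq_trans)
qed

lemma alpha_gen_fn_str: "(x, y) \<in> alpha_gen \<Longrightarrow> fn_str x = fn_str y"
proof (induction x arbitrary: y)
  case (Cons l x)
  from Cons.prems show ?case
  proof (cases rule: alpha_gen_cases)
    case (Bar a v b u)
    then have "(a = b \<and> v = u) \<or> (a \<noteq> b \<and> b \<notin> names_str v \<and> u = perm_str (swp a b) v)"
      by (simp add: str.abs_eq_iff)
    then show ?thesis
    proof
      assume *: "a \<noteq> b \<and> b \<notin> names_str v \<and> u = perm_str (swp a b) v"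
      then have "b \<notin> fn_str (Bar a # v)" using fn_str_names[of v] by auto
      then show ?thesis using fn_str_Bar_swp Bar * by metis
    qed (use Bar in simp)
  next
    case (Cons l v u)
    then show ?thesis using Cons.IH fn_str_Cons_cong by blast
  qed
qed simp

lemma alpha_eq_fn_str: "alpha_eq x y \<Longrightarrow> fn_str x = fn_str y"
  unfolding alpha_eq_alt by (induction rule: rtrancl_induct) (auto dest: alpha_gen_fn_str)

lemma abs_eq_str_perm:
  assumes "fperm \<pi>" "abs_eq perm_str names_str a v b u"
  shows "abs_eq perm_str names_str (\<pi> a) (perm_str \<pi> v) (\<pi> b) (perm_str \<pi> u)"
proof -
  have "perm_str \<pi> (perm_str (swp a b) v) = perm_str (swp (\<pi> a) (\<pi> b)) (perm_str \<pi> v)"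
    using assms(1) by (simp only: perm_str_comp comp_swp)
  then show ?thesis
    using assms fperm_inj[OF assms(1)] by (auto simp: str.abs_eq_iff inj_eq inj_image_mem_iff)
qed

lemma alpha_gen_perm:
  assumes "fperm \<pi>" "(x, y) \<in> alpha_gen"
  shows "(perm_str \<pi> x, perm_str \<pi> y) \<in> alpha_gen"
  using assms(2)
proof (induction x arbitrary: y)
  case (Cons l x)
  from Cons.prems show ?case
  proof (cases rule: alpha_gen_cases)
    case (Bar a v b u)
    then show ?thesis using abs_eq_str_perm[OF assms(1)] by (auto intro: alpha_gen_Bar)
  next
    case (Cons l v u)
    then show ?thesis using Cons.IH by (auto intro: alpha_gen_Cons)
  qed
qed simp

lemma alpha_eq_perm: "fperm \<pi> \<Longrightarrow> alpha_eq x y \<Longrightarrow> alpha_eq (perm_str \<pi> x) (perm_str \<pi> y)"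
  unfolding alpha_eq_alt
  by (erule rtrancl_induct) (simp, meson alpha_gen_perm rtrancl_into_rtrancl)

lemma alpha_eq_Nil: "alpha_eq [] y \<Longrightarrow> y = []"
  unfolding alpha_eq_alt by (induction rule: rtrancl_induct) auto

lemma alpha_eq_Plain:
  assumes "alpha_eq (Plain a # v) y"
  obtains u where "y = Plain a # u" "alpha_eq v u"
proof -
  have "\<exists>u. y = Plain a # u \<and> alpha_eq v u"
    using assms unfolding alpha_eq_alt
    by (induction rule: rtrancl_induct) (auto elim!: alpha_gen_Plain intro: rtrancl_into_rtrancl)
  then show thesis using that by blast
qed

text \<open>Cancellation is claimed for every \<open>c\<close> outside the free names, not just for
  some fresh one, so that one \<open>c\<close> can be carried through the whole chain even if an
  intermediate word contains it as a bound name.\<close>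

lemma alpha_eq_Bar:
  assumes "alpha_eq (Bar a # v) y"
  obtains b u where "y = Bar b # u"
    "\<And>c. c \<notin> fn_str (Bar a # v) \<Longrightarrow> alpha_eq (perm_str (swp a c) v) (perm_str (swp b c) u)"
proof -
  have "\<exists>b u. y = Bar b # u \<and>
    (\<forall>c. c \<notin> fn_str (Bar a # v) \<longrightarrow> alpha_eq (perm_str (swp a c) v) (perm_str (swp b c) u))"
    using assms unfolding alpha_eq_alt
  proof (induction rule: rtrancl_induct)
    case base
    then show ?case by auto
  next
    case (step y z)
    then obtain d y' where y: "y = Bar d # y'"
      and IH: "\<And>c. c \<notin> fn_str (Bar a # v) \<Longrightarrow> alpha_eq (perm_str (swp a c) v) (perm_str (swp d c) y')"
      unfolding alpha_eq_alt by blast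
    \<comment> \<open>Free names are invariant along the chain, so the side condition on
      \<open>c\<close> is the same at every step.\<close>
    have fn: "fn_str (Bar a # v) = fn_str y"
      using step.hyps(1) by (intro alpha_eq_fn_str) (simp only: alpha_eq_alt)
    have "\<exists>b u. z = Bar b # u \<and>
      (\<forall>c. c \<notin> fn_str y \<longrightarrow> alpha_eq (perm_str (swp d c) y') (perm_str (swp b c) u))"
      using step.hyps(2)
    proof (cases rule: alpha_gen_cases)
      case (Cons l v u)
      then have "z = Bar d # u" "(y', u) \<in> alpha_gen"
        using y by auto
      then show ?thesis
        unfolding alpha_eq_alt by (blast intro: alpha_gen_perm[OF fperm_swp])
    next
      case (Bar d' y'' b u)
      then have d: "d' = d" "y'' = y'" using y by auto
      from Bar(3) consider "d = b" "y' = u" | "d \<noteq> b" "b \<notin> names_str y'" "u = perm_str (swp d b) y'"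
        by (auto simp: str.abs_eq_iff d)
      then show ?thesis
      proof cases
        case 1
        then show ?thesis using Bar by auto
      next
        case 2
        have "alpha_eq (perm_str (swp d c) y') (perm_str (swp b c) u)" if "c \<notin> fn_str y" for c
        proof -
          have "alpha_eq (perm_str (swp d c) y') (perm_str (swp b c \<circ> swp d b) y')"
          proof (rule alpha_eq_perm_cong)
            fix x assume "x \<in> fn_str y'"
            then show "swp d c x = (swp b c \<circ> swp d b) x"
              using 2 that y fn_str_names[of y'] by (auto simp: swp_def)
          qed auto
          then show ?thesis by (simp add: 2)
        qed
        then show ?thesis using Bar by auto
      qed
    qed
    then obtain b u where z: "z = Bar b # u"
      and "\<And>c. c \<notin> fn_str y \<Longrightarrow> alpha_eq (perm_str (swp d c) y') (perm_str (swp b c) u)"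
      by blast
    then have "\<forall>c. c \<notin> fn_str (Bar a # v) \<longrightarrow> alpha_eq (perm_str (swp a c) v) (perm_str (swp b c) u)"
      unfolding fn using IH[unfolded fn] alpha_eq_trans by blast
    with z show ?case
      unfolding alpha_eq_alt by blast
  qed
  then show thesis using that by blast
qed

section \<open>Formulae and satisfaction\<close>

lemma perm_fml_id [simp]: "perm_fml id \<phi> = \<phi>"
  by (induction \<phi>) (simp_all only: perm_fml.simps perm_bl_id)

lemma perm_fml_comp [simp]: "perm_fml \<pi> (perm_fml \<sigma> \<phi>) = perm_fml (\<pi> \<circ> \<sigma>) \<phi>"
  by (induction \<phi>) (simp_all only: perm_fml.simps perm_bl_comp)

lemma finite_names_fml [simp]: "finite (names_fml \<phi>)"
  by (induction \<phi>) auto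

lemma names_fml_perm [simp]: "names_fml (perm_fml \<pi> \<phi>) = \<pi> ` names_fml \<phi>"
  by (induction \<phi>) auto

lemma perm_fml_cong:
  "(\<And>a. a \<in> names_fml \<phi> \<Longrightarrow> \<pi> a = \<sigma> a) \<Longrightarrow> perm_fml \<pi> \<phi> = perm_fml \<sigma> \<phi>"
  by (induction \<phi>) (auto intro: perm_bl_cong)

interpretation fml: name_action UNIV perm_fml names_fml
  by unfold_locales (auto intro: perm_fml_cong simp del: perm_fml_comp simp: perm_fml_comp perm_fml_id)

lemma names_fml_fn_bn: "names_fml \<phi> = fn_fml \<phi> \<union> bn_fml \<phi>"
proof (induction \<phi>)
  case (Dia \<sigma> \<phi>)
  then show ?case by (cases \<sigma>) auto
next
  case (Box \<sigma> \<phi>)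
  then show ?case by (cases \<sigma>) auto
qed auto

lemma fn_fml_names: "fn_fml \<phi> \<subseteq> names_fml \<phi>"
  by (simp add: names_fml_fn_bn)

lemma fn_fml_perm: "inj \<pi> \<Longrightarrow> fn_fml (perm_fml \<pi> \<phi>) = \<pi> ` fn_fml \<phi>"
  by (induction \<phi> rule: fn_fml.induct) (simp_all add: image_set_diff image_Un)

lemma perm_fml_subst:
  "perm_fml \<pi> (subst \<phi> X \<psi>) = subst (perm_fml \<pi> \<phi>) X (perm_fml \<pi> \<psi>)"
  by (induction \<phi>) auto

lemma names_fml_subst: "names_fml (subst \<phi> X \<psi>) \<subseteq> names_fml \<phi> \<union> names_fml \<psi>"
  by (induction \<phi>) auto

lemma fn_fml_subst: "fn_fml (subst \<phi> X \<psi>) \<subseteq> fn_fml \<phi> \<union> fn_fml \<psi>"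
  by (induction \<phi> rule: fn_fml.induct) (simp_all, blast+)

lemma abs_eq_fml_perm:
  assumes "fperm \<pi>" "abs_eq perm_fml names_fml a \<phi> b \<psi>"
  shows "abs_eq perm_fml names_fml (\<pi> a) (perm_fml \<pi> \<phi>) (\<pi> b) (perm_fml \<pi> \<psi>)"
proof -
  have "perm_fml \<pi> (perm_fml (swp a b) \<phi>) = perm_fml (swp (\<pi> a) (\<pi> b)) (perm_fml \<pi> \<phi>)"
    using assms(1) by (simp only: perm_fml_comp comp_swp)
  moreover have "\<pi> a = \<pi> b \<longleftrightarrow> a = b" "\<pi> b \<in> \<pi> ` names_fml \<phi> \<longleftrightarrow> b \<in> names_fml \<phi>"
    using fperm_inj[OF assms(1)] by (simp_all add: inj_eq inj_image_mem_iff)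
  ultimately show ?thesis
    using assms(2) unfolding fml.abs_eq_iff[OF UNIV_I UNIV_I] names_fml_perm by metis
qed

\<comment> \<open>Equivariance and alpha-invariance of satisfaction\<close>
inductive_simps sat_Eps [simp]: "sat S w Eps"
inductive_simps sat_NEps [simp]: "sat S w NEps"
inductive_simps sat_Conj [simp]: "sat S w (Conj \<phi> \<psi>)"
inductive_simps sat_Disj [simp]: "sat S w (Disj \<phi> \<psi>)"
inductive_simps sat_Dia_Plain [simp]: "sat S w (Dia (Plain a) \<phi>)"
inductive_simps sat_Box_Plain [simp]: "sat S w (Box (Plain a) \<phi>)"
inductive_simps sat_Dia_Bar: "sat S w (Dia (Bar a) \<phi>)"
inductive_simps sat_Box_Bar: "sat S w (Box (Bar a) \<phi>)"

lemma perm_str_inv: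
  assumes "fperm \<pi>"
  shows "perm_str \<pi> (perm_str (inv \<pi>) w) = w" "perm_str (inv \<pi>) (perm_str \<pi> w) = w"
  using assms by (simp_all only: perm_str_comp inv_comp_fperm comp_inv_fperm perm_str_id)

lemma perm_fml_inv:
  assumes "fperm \<pi>"
  shows "perm_fml \<pi> (perm_fml (inv \<pi>) \<phi>) = \<phi>" "perm_fml (inv \<pi>) (perm_fml \<pi> \<phi>) = \<phi>"
  using assms by (simp_all only: perm_fml_comp inv_comp_fperm comp_inv_fperm perm_fml_id)

lemma fperm_inv_apply:
  assumes "fperm \<pi>"
  shows "\<pi> (inv \<pi> a) = a" "inv \<pi> (\<pi> a) = a"
  using assms by (simp_all add: fperm_def bij_is_surj bij_is_inj surj_f_inv_f inv_f_f)

text \<open>With the target context universally quantified, the bar cases can use the induction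
  hypothesis for a context extended by the renamed name. Boxes quantify over decompositions of the
  renamed word, which are pulled back along the inverse permutation.\<close>

lemma sat_perm:
  assumes "sat S w \<phi>" "fperm \<pi>"
  shows "sat S' (perm_str \<pi> w) (perm_fml \<pi> \<phi>)"
  using assms
proof (induction arbitrary: S' rule: sat.induct)
  case (s_mu S w \<phi> X)
  then have "sat S' (perm_str \<pi> w) (perm_fml \<pi> (subst \<phi> X (Mu X \<phi>)))"
    by blast
  then show ?case by (simp add: perm_fml_subst sat.s_mu)
next
  case (s_box w a S \<phi>)
  have "sat S' v (perm_fml \<pi> \<phi>)" if "perm_str \<pi> w = Plain (\<pi> a) # v" for v
  proof -
    have "w = perm_str (inv \<pi>) (Plain (\<pi> a) # v)"
      by (simp only: that[symmetric] perm_str_inv[OF s_box.prems])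
    then have "w = Plain a # perm_str (inv \<pi>) v"
      by (simp add: fperm_inv_apply[OF s_box.prems])
    then have "sat S' (perm_str \<pi> (perm_str (inv \<pi>) v)) (perm_fml \<pi> \<phi>)"
      using s_box by blast
    then show ?thesis by (simp only: perm_str_inv[OF s_box.prems])
  qed
  then show ?case by (auto intro: sat.s_box)
next
  case (s_diabar w b v a \<phi> \<psi> S)
  have "alpha_eq (perm_str \<pi> w) (Bar (\<pi> b) # perm_str \<pi> v)"
    using alpha_eq_perm[OF s_diabar.prems s_diabar.hyps(1)] by simp
  then show ?case
    using s_diabar abs_eq_fml_perm[OF s_diabar.prems s_diabar.hyps(2)] by (auto intro: sat.s_diabar)
next
  case (s_boxbar w a \<phi> S)
  have "sat (insert b S') v \<psi>"
    if *: "alpha_eq (perm_str \<pi> w) (Bar b # v)" "abs_eq perm_fml names_fml (\<pi> a) (perm_fml \<pi> \<phi>) b \<psi>"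
    for \<psi> v b
  proof -
    note \<pi> = s_boxbar.prems
    have "alpha_eq w (Bar (inv \<pi> b) # perm_str (inv \<pi>) v)"
      using alpha_eq_perm[OF fperm_inv[OF \<pi>] *(1)] by (simp only: perm_str_inv[OF \<pi>] perm_str_simps perm_bl.simps)
    moreover have "abs_eq perm_fml names_fml a \<phi> (inv \<pi> b) (perm_fml (inv \<pi>) \<psi>)"
      using abs_eq_fml_perm[OF fperm_inv[OF \<pi>] *(2)] by (simp only: perm_fml_inv[OF \<pi>] fperm_inv_apply[OF \<pi>])
    ultimately have "sat (insert b S') (perm_str \<pi> (perm_str (inv \<pi>) v)) (perm_fml \<pi> (perm_fml (inv \<pi>) \<psi>))"
      using s_boxbar.IH \<pi> by blast
    then show ?thesis by (simp only: perm_str_inv[OF \<pi>] perm_fml_inv[OF \<pi>])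
  qed
  then show ?case by (auto intro: sat.s_boxbar)
qed (auto intro: sat.intros)

lemma sat_perm_iff:
  assumes "fperm \<pi>"
  shows "sat S (perm_str \<pi> w) (perm_fml \<pi> \<phi>) \<longleftrightarrow> sat S' w \<phi>"
  using sat_perm[of S "perm_str \<pi> w" "perm_fml \<pi> \<phi>" "inv \<pi>"] sat_perm[of S' w \<phi> \<pi>] assms
  by (auto simp only: perm_str_inv perm_fml_inv fperm_inv)

lemma sat_context: "sat S w \<phi> \<longleftrightarrow> sat {} w \<phi>"
  using sat_perm_iff[OF fperm_id, of S w \<phi> "{}"] by (simp only: perm_str_id perm_fml_id)

lemma sat_alpha_eq_imp:
  assumes "sat S w \<phi>" "alpha_eq w w'"
  shows "sat S w' \<phi>"
  using assms
proof (induction arbitrary: w' rule: sat.induct)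
  case (s_neps w S)
  then have "w' \<noteq> []"
    using alpha_eq_sym[OF s_neps.prems] s_neps.hyps alpha_eq_Nil by blast
  then show ?case by simp
next
  case (s_dia S v \<phi> a)
  then show ?case by (auto elim!: alpha_eq_Plain)
next
  case (s_box w a S \<phi>)
  have "sat S v \<phi>" if w': "w' = Plain a # v" for v
  proof -
    obtain u where "w = Plain a # u" "alpha_eq v u"
      using alpha_eq_sym[OF s_box.prems] unfolding w' by (rule alpha_eq_Plain)
    then show ?thesis using s_box.IH alpha_eq_sym by blast
  qed
  then show ?case by simp
next
  case (s_diabar w b v a \<phi> \<psi> S)
  then show ?case by (meson sat.s_diabar alpha_eq_sym alpha_eq_trans)
next
  case (s_boxbar w a \<phi> S)
  then show ?case by (intro sat.s_boxbar) (meson alpha_eq_refl alpha_eq_trans)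
qed (auto intro: sat.intros dest: alpha_eq_Nil)

lemma sat_alpha_eq: "alpha_eq w w' \<Longrightarrow> sat S w \<phi> \<longleftrightarrow> sat S w' \<phi>"
  using sat_alpha_eq_imp alpha_eq_sym by blast

lemma sat_perm_cong:
  assumes "fperm \<pi>" "fperm \<sigma>" "\<And>a. a \<in> fn_str v \<Longrightarrow> \<pi> a = \<sigma> a"
  shows "sat S (perm_str \<pi> v) \<phi> \<longleftrightarrow> sat S (perm_str \<sigma> v) \<phi>"
  by (intro sat_alpha_eq alpha_eq_perm_cong assms)

lemma abs_eq_swp_fresh:
  assumes "abs_eq perm_fml names_fml a \<phi> b \<psi>" "c \<notin> insert a (names_fml \<phi>)"
  shows "perm_fml (swp b c) \<psi> = perm_fml (swp a c) \<phi>"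
proof -
  from assms(1) consider "a = b" "\<phi> = \<psi>" | "a \<noteq> b" "b \<notin> names_fml \<phi>" "\<psi> = perm_fml (swp a b) \<phi>"
    by (auto simp: fml.abs_eq_iff)
  then show ?thesis
  proof cases
    case 2
    have "perm_fml (swp b c \<circ> swp a b) \<phi> = perm_fml (swp a c) \<phi>"
    proof (rule perm_fml_cong)
      fix x assume "x \<in> names_fml \<phi>"
      then show "(swp b c \<circ> swp a b) x = swp a c x"
        using 2 assms(2) by (auto simp: swp_def)
    qed
    then show ?thesis by (simp only: 2 perm_fml_comp)
  qed simp
qed

text \<open>Both bound names are moved to a common fresh \<open>c\<close>. The tails then become
  alpha-equivalent by cancellation, the formulae become identical, and equivariance removes the swap
  again.\<close>

lemma sat_Bar_choice:
  assumes "alpha_eq (Bar b # v) (Bar b' # v')" "abs_eq perm_fml names_fml a \<phi> b' \<psi>"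
    and "c \<notin> insert a (names_fml \<phi>)" "c \<notin> insert b (names_str v)"
  shows "sat S v' \<psi> \<longleftrightarrow> sat S' (perm_str (swp b c) v) (perm_fml (swp a c) \<phi>)"
proof -
  have "c \<notin> fn_str (Bar b # v)"
    using assms(4) fn_str_names by auto
  then have "alpha_eq (perm_str (swp b c) v) (perm_str (swp b' c) v')"
    using assms(1) by (auto elim!: alpha_eq_Bar)
  then have "sat S' (perm_str (swp b c) v) (perm_fml (swp a c) \<phi>) \<longleftrightarrow>
      sat S' (perm_str (swp b' c) v') (perm_fml (swp b' c) \<psi>)"
    using abs_eq_swp_fresh[OF assms(2,3)] by (simp add: sat_alpha_eq)
  then show ?thesis
    by (simp add: sat_perm_iff[OF fperm_swp, of S' b' c v' \<psi> S])
qed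

text \<open>The choice of the bound name is immaterial, so on words starting with a bar name the two bar
  modalities coincide.\<close>

lemma
  assumes "c \<notin> insert a (names_fml \<phi>)" "c \<notin> insert b (names_str v)"
  shows sat_Dia_Bar_fresh:
      "sat {} (Bar b # v) (Dia (Bar a) \<phi>) \<longleftrightarrow> sat {} (perm_str (swp b c) v) (perm_fml (swp a c) \<phi>)"
    and sat_Box_Bar_fresh:
      "sat {} (Bar b # v) (Box (Bar a) \<phi>) \<longleftrightarrow> sat {} (perm_str (swp b c) v) (perm_fml (swp a c) \<phi>)"
proof -
  have "alpha_eq (Bar b # v) (Bar c # perm_str (swp b c) v)"
    using assms(2) by (simp add: alpha_eq_Bar_fresh)
  moreover have "abs_eq perm_fml names_fml a \<phi> c (perm_fml (swp a c) \<phi>)"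
    using assms(1) by (auto simp: fml.abs_eq_iff)
  moreover note sat_Bar_choice[OF _ _ assms]
  ultimately show
    "sat {} (Bar b # v) (Dia (Bar a) \<phi>) \<longleftrightarrow> sat {} (perm_str (swp b c) v) (perm_fml (swp a c) \<phi>)"
    "sat {} (Bar b # v) (Box (Bar a) \<phi>) \<longleftrightarrow> sat {} (perm_str (swp b c) v) (perm_fml (swp a c) \<phi>)"
    unfolding sat_Dia_Bar sat_Box_Bar by blast+
qed

lemma sat_Bar_not_Bar:
  assumes "\<And>b v. w \<noteq> Bar b # v"
  shows "\<not> sat S w (Dia (Bar a) \<phi>)" "sat S w (Box (Bar a) \<phi>)"
proof -
  have "\<not> alpha_eq w (Bar b # v)" for b v
    using assms by (auto dest!: alpha_eq_sym elim!: alpha_eq_Bar)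
  then show "\<not> sat S w (Dia (Bar a) \<phi>)" "sat S w (Box (Bar a) \<phi>)"
    by (auto simp: sat_Dia_Bar sat_Box_Bar)
qed

text \<open>Truth of formulae in a class closed under the non-modal constructors is determined by
  truth of its modal members; least fixpoints need no guardedness for this, since \<^const>\<open>sat\<close>
  is inductive.\<close>

definition unfold_closed :: "fml set \<Rightarrow> bool" where
  "unfold_closed F \<longleftrightarrow>
     (\<forall>\<phi> \<psi>. Conj \<phi> \<psi> \<in> F \<or> Disj \<phi> \<psi> \<in> F \<longrightarrow> \<phi> \<in> F \<and> \<psi> \<in> F) \<and>
     (\<forall>X \<phi>. Mu X \<phi> \<in> F \<longrightarrow> subst \<phi> X (Mu X \<phi>) \<in> F)"

lemma unfold_closedD:
  assumes "unfold_closed F"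
  shows "Conj \<phi> \<psi> \<in> F \<Longrightarrow> \<phi> \<in> F" "Conj \<phi> \<psi> \<in> F \<Longrightarrow> \<psi> \<in> F"
    and "Disj \<phi> \<psi> \<in> F \<Longrightarrow> \<phi> \<in> F" "Disj \<phi> \<psi> \<in> F \<Longrightarrow> \<psi> \<in> F"
    and "Mu X \<phi> \<in> F \<Longrightarrow> subst \<phi> X (Mu X \<phi>) \<in> F"
  using assms unfolding unfold_closed_def by blast+

text \<open>The derivation is followed through the rules that keep the word fixed and is cut off at
  the first modality, where the hypotheses on \<open>Dia\<close> and \<open>Box\<close> take
  over.\<close>

lemma sat_modal_imp:
  assumes "unfold_closed F" and Nil: "w = [] \<longleftrightarrow> w' = []"
    and Dia: "\<And>\<sigma> \<phi>. Dia \<sigma> \<phi> \<in> F \<Longrightarrow> sat {} w (Dia \<sigma> \<phi>) \<Longrightarrow> sat {} w' (Dia \<sigma> \<phi>)"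
    and Box: "\<And>\<sigma> \<phi>. Box \<sigma> \<phi> \<in> F \<Longrightarrow> sat {} w (Box \<sigma> \<phi>) \<Longrightarrow> sat {} w' (Box \<sigma> \<phi>)"
    and "sat S w \<chi>" "\<chi> \<in> F"
  shows "sat {} w' \<chi>"
proof -
  have "w0 = w \<Longrightarrow> \<chi> \<in> F \<Longrightarrow> sat {} w' \<chi>" if "sat S w0 \<chi>" for w0
    using that
  proof (induction rule: sat.induct)
    case (s_mu S w \<phi> X)
    then show ?case
      using unfold_closedD(5)[OF assms(1)] sat.s_mu by blast
  next
    case (s_dia S v \<phi> a)
    then have "sat S w (Dia (Plain a) \<phi>)" by (auto intro: sat.s_dia)
    then show ?case using Dia s_dia.prems sat_context by blast
  next
    case (s_box v a S \<phi>)
    then have "sat S w (Box (Plain a) \<phi>)" by (auto intro: sat.s_box)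
    then show ?case using Box s_box.prems sat_context by blast
  next
    case (s_diabar v b u a \<phi> \<psi> S)
    then have "sat S w (Dia (Bar a) \<phi>)" by (auto intro: sat.s_diabar)
    then show ?case using Dia s_diabar.prems sat_context by blast
  next
    case (s_boxbar v a \<phi> S)
    then have "sat S w (Box (Bar a) \<phi>)" by (auto intro: sat.s_boxbar)
    then show ?case using Box s_boxbar.prems sat_context by blast
  qed (use Nil in \<open>auto dest: unfold_closedD[OF assms(1)]\<close>)
  then show ?thesis using assms by blast
qed

lemma unfold_closed_not_free: "unfold_closed {\<chi>. a \<notin> fn_fml \<chi>}"
  using fn_fml_subst unfolding unfold_closed_def by fastforce

text \<open>At a free plain name that the formula does not mention, diamonds fail and boxes hold,
  whatever follows.\<close>

lemma sat_append_imp: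
  assumes "a \<in> fn_str y" "a \<notin> fn_fml \<chi>" "sat {} (y @ u) \<chi>"
  shows "sat {} (y @ u') \<chi>"
  using assms
\<comment> \<open>Length rather than structure, because below a binder the hypothesis is applied to
  a renamed copy of the tail.\<close>
proof (induction "length y" arbitrary: y u u' \<chi> rule: less_induct)
  case less
  then obtain l y' where y: "y = l # y'"
    by (cases y) auto
  note IH = less.hyps[of "perm_str _ y'", simplified y, simplified]
  show ?case
  proof (rule sat_modal_imp[OF unfold_closed_not_free[of a], where w = "y @ u" and \<chi> = \<chi>])
    fix \<sigma> \<phi>
    assume \<phi>: "Dia \<sigma> \<phi> \<in> {\<chi>. a \<notin> fn_fml \<chi>}" and sat: "sat {} (y @ u) (Dia \<sigma> \<phi>)"
    show "sat {} (y @ u') (Dia \<sigma> \<phi>)"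
    proof (cases \<sigma>)
      case (Plain d)
      then show ?thesis
        using \<phi> sat less.prems(1) less.hyps[of y' \<phi> u u'] by (auto simp: y)
    next
      case \<sigma>: (Bar d)
      then obtain b where l: "l = Bar b"
        using sat sat_Bar_not_Bar(1) y by (metis append_Cons list.inject)
      have "finite (insert a (insert d (names_fml \<phi>) \<union> insert b (names_str (y' @ u) \<union> names_str (y' @ u'))))"
        by simp
      then obtain c where c: "c \<notin> insert a (insert d (names_fml \<phi>) \<union> insert b (names_str (y' @ u) \<union> names_str (y' @ u')))"
        by (rule fresh_name)
      then have *: "c \<notin> insert d (names_fml \<phi>)" "c \<notin> insert b (names_str (y' @ u))"
        "c \<notin> insert b (names_str (y' @ u'))" by simp_all
      have "a \<in> fn_str y'" "a \<noteq> b"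
        using less.prems(1) by (simp_all add: y l)
      \<comment> \<open>Since \<open>a\<close> differs from \<open>b\<close> and \<open>c\<close>,
        it remains free in the renamed tail. It also stays out of the renamed formula, even if
        \<open>a = d\<close>, because then it has been replaced by \<open>c\<close>.\<close>
      then have "a \<in> fn_str (perm_str (swp b c) y')"
        using c by (auto simp: fn_str_perm fperm_inj image_iff intro!: bexI[of _ a])
      moreover have "a \<notin> fn_fml (perm_fml (swp d c) \<phi>)"
        using \<phi> c fn_fml_names[of \<phi>] fn_fml_perm[OF fperm_inj[OF fperm_swp], of d c \<phi>]
          by (auto simp: \<sigma> swp_def split: if_splits)
      ultimately show ?thesis
        using sat IH
        by (simp add: \<sigma> y l sat_Dia_Bar_fresh[OF *(1,2)] sat_Dia_Bar_fresh[OF *(1,3)])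
    qed
  next
    fix \<sigma> \<phi>
    assume \<phi>: "Box \<sigma> \<phi> \<in> {\<chi>. a \<notin> fn_fml \<chi>}" and sat: "sat {} (y @ u) (Box \<sigma> \<phi>)"
    show "sat {} (y @ u') (Box \<sigma> \<phi>)"
    proof (cases \<sigma>)
      case (Plain d)
      then show ?thesis
        using \<phi> sat less.prems(1) less.hyps[of y' \<phi> u u'] by (auto simp: y)
    next
      case \<sigma>: (Bar d)
      show ?thesis
      proof (cases l)
        case (Plain b)
        then show ?thesis by (simp add: \<sigma> y sat_Bar_not_Bar)
      next
        case l: (Bar b)
        have "finite (insert a (insert d (names_fml \<phi>) \<union> insert b (names_str (y' @ u) \<union> names_str (y' @ u'))))"
          by simp
        then obtain c where c: "c \<notin> insert a (insert d (names_fml \<phi>) \<union> insert b (names_str (y' @ u) \<union> names_str (y' @ u')))"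
          by (rule fresh_name)
        then have *: "c \<notin> insert d (names_fml \<phi>)" "c \<notin> insert b (names_str (y' @ u))"
          "c \<notin> insert b (names_str (y' @ u'))" by simp_all
        have "a \<in> fn_str y'" "a \<noteq> b"
          using less.prems(1) by (simp_all add: y l)
        then have "a \<in> fn_str (perm_str (swp b c) y')"
          using c by (auto simp: fn_str_perm fperm_inj image_iff intro!: bexI[of _ a])
        moreover have "a \<notin> fn_fml (perm_fml (swp d c) \<phi>)"
          using \<phi> c fn_fml_names[of \<phi>] fn_fml_perm[OF fperm_inj[OF fperm_swp], of d c \<phi>]
            by (auto simp: \<sigma> swp_def split: if_splits)
        ultimately show ?thesis
          using sat IH
          by (simp add: \<sigma> y l sat_Box_Bar_fresh[OF *(1,2)] sat_Box_Bar_fresh[OF *(1,3)])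
      qed
    qed
  qed (use less.prems y in auto)
qed

section \<open>The closure is finite\<close>

text \<open>Bound variables are not renamed. Capture cannot arise in the intended use, where free
  variables of the argument are mapped to closed formulae.\<close>

fun simul_subst :: "(nat \<Rightarrow> fml) \<Rightarrow> fml \<Rightarrow> fml" where
  "simul_subst \<theta> Eps = Eps"
| "simul_subst \<theta> NEps = NEps"
| "simul_subst \<theta> (Conj \<phi> \<psi>) = Conj (simul_subst \<theta> \<phi>) (simul_subst \<theta> \<psi>)"
| "simul_subst \<theta> (Disj \<phi> \<psi>) = Disj (simul_subst \<theta> \<phi>) (simul_subst \<theta> \<psi>)"
| "simul_subst \<theta> (Dia \<sigma> \<phi>) = Dia \<sigma> (simul_subst \<theta> \<phi>)"
| "simul_subst \<theta> (Box \<sigma> \<phi>) = Box \<sigma> (simul_subst \<theta> \<phi>)"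
| "simul_subst \<theta> (FVar X) = \<theta> X"
| "simul_subst \<theta> (Mu X \<phi>) = Mu X (simul_subst (\<theta>(X := FVar X)) \<phi>)"

text \<open>Instances of subformulae, where bound variables are expanded to their fixpoints: unlike
  \<^const>\<open>cl\<close> this is defined by structural recursion, hence visibly finite.\<close>

fun cl_inst :: "(nat \<Rightarrow> fml) \<Rightarrow> fml \<Rightarrow> fml set" where
  "cl_inst \<theta> Eps = {Eps}"
| "cl_inst \<theta> NEps = {NEps}"
| "cl_inst \<theta> (Conj \<phi> \<psi>) = insert (simul_subst \<theta> (Conj \<phi> \<psi>)) (cl_inst \<theta> \<phi> \<union> cl_inst \<theta> \<psi>)"
| "cl_inst \<theta> (Disj \<phi> \<psi>) = insert (simul_subst \<theta> (Disj \<phi> \<psi>)) (cl_inst \<theta> \<phi> \<union> cl_inst \<theta> \<psi>)"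
| "cl_inst \<theta> (Dia \<sigma> \<phi>) = insert (simul_subst \<theta> (Dia \<sigma> \<phi>)) (cl_inst \<theta> \<phi>)"
| "cl_inst \<theta> (Box \<sigma> \<phi>) = insert (simul_subst \<theta> (Box \<sigma> \<phi>)) (cl_inst \<theta> \<phi>)"
| "cl_inst \<theta> (FVar X) = {\<theta> X}"
| "cl_inst \<theta> (Mu X \<phi>) = insert (simul_subst \<theta> (Mu X \<phi>)) (cl_inst (\<theta>(X := simul_subst \<theta> (Mu X \<phi>))) \<phi>)"

fun succs :: "fml \<Rightarrow> fml set" where
  "succs (Conj \<phi> \<psi>) = {\<phi>, \<psi>}"
| "succs (Disj \<phi> \<psi>) = {\<phi>, \<psi>}"
| "succs (Dia \<sigma> \<phi>) = {\<phi>}"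
| "succs (Box \<sigma> \<phi>) = {\<phi>}"
| "succs (Mu X \<phi>) = {subst \<phi> X (Mu X \<phi>)}"
| "succs _ = {}"

lemma cl_least:
  assumes "\<phi> \<in> C" "\<And>\<chi>. \<chi> \<in> C \<Longrightarrow> succs \<chi> \<subseteq> C"
  shows "cl \<phi> \<subseteq> C"
proof
  fix \<chi> assume "\<chi> \<in> cl \<phi>"
  then show "\<chi> \<in> C"
    by (induction rule: cl.induct) (use assms in \<open>force+\<close>)
qed

lemma finite_cl_inst: "finite (cl_inst \<theta> \<phi>)"
  by (induction \<phi> arbitrary: \<theta>) auto

lemma simul_subst_in_cl_inst: "simul_subst \<theta> \<phi> \<in> cl_inst \<theta> \<phi>"
  by (cases \<phi>) auto

lemma simul_subst_FVar [simp]: "simul_subst FVar \<phi> = \<phi>"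
  by (induction \<phi>) auto

lemma fv_simul_subst: "fv (simul_subst \<theta> \<phi>) \<subseteq> (\<Union>X\<in>fv \<phi>. fv (\<theta> X))"
proof (induction \<phi> arbitrary: \<theta>)
  case (Mu X \<phi>)
  show ?case
  proof
    fix x assume "x \<in> fv (simul_subst \<theta> (Mu X \<phi>))"
    then have "x \<noteq> X" "x \<in> fv (simul_subst (\<theta>(X := FVar X)) \<phi>)"
      by simp_all
    with Mu.IH[of "\<theta>(X := FVar X)"] obtain Y where Y: "Y \<in> fv \<phi>" "x \<in> fv ((\<theta>(X := FVar X)) Y)"
      by blast
    with \<open>x \<noteq> X\<close> have "Y \<noteq> X" by (cases "Y = X") simp_all
    with Y show "x \<in> (\<Union>Y\<in>fv (Mu X \<phi>). fv (\<theta> Y))" by auto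
  qed
qed (simp_all, blast+)

lemma subst_fresh: "X \<notin> fv \<phi> \<Longrightarrow> subst \<phi> X \<psi> = \<phi>"
  by (induction \<phi>) auto

text \<open>This makes unfolding an operation on substitutions: the unfolding of an instance of a
  fixpoint is the instance of its body under an extended \<open>\<theta>\<close>. The hypothesis
  prevents \<open>X\<close> from entering through \<open>\<theta>\<close> itself.\<close>

lemma subst_simul_subst:
  assumes "\<And>Y. Y \<in> fv \<phi> \<Longrightarrow> Y \<noteq> X \<Longrightarrow> X \<notin> fv (\<theta> Y)"
  shows "subst (simul_subst (\<theta>(X := FVar X)) \<phi>) X \<psi> = simul_subst (\<theta>(X := \<psi>)) \<phi>"
  using assms
proof (induction \<phi> arbitrary: \<theta>)
  case (FVar Y)
  then show ?case by (simp add: subst_fresh)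
next
  case (Mu Y \<phi>)
  show ?case
  proof (cases "Y = X")
    case False
    have "subst (simul_subst ((\<theta>(Y := FVar Y))(X := FVar X)) \<phi>) X \<psi> =
        simul_subst ((\<theta>(Y := FVar Y))(X := \<psi>)) \<phi>"
      by (rule Mu.IH) (use Mu.prems False in auto)
    with False show ?thesis
      by (simp only: fun_upd_twist[OF False] simul_subst.simps subst.simps if_False)
  next
    case True
    show ?thesis
      unfolding True by (simp only: fun_upd_upd simul_subst.simps subst.simps simp_thms if_True)
  qed
qed auto

text \<open>Successors can leave the set of instances only at a variable, where the instance is
  \<open>\<theta> X\<close>. The set \<open>B\<close> collects the successors reached there; for a
  closed formula no variable is free at the top and \<open>B\<close> may be empty.\<close>

lemma succs_cl_inst:
  assumes "\<And>X. X \<in> fv \<psi> \<Longrightarrow> fv (\<theta> X) = {}" "\<And>X. X \<in> fv \<psi> \<Longrightarrow> succs (\<theta> X) \<subseteq> B"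
    and "\<chi> \<in> cl_inst \<theta> \<psi>"
  shows "succs \<chi> \<subseteq> cl_inst \<theta> \<psi> \<union> B"
  using assms
proof (induction \<psi> arbitrary: \<theta> B)
  case (Conj \<psi>1 \<psi>2)
  from Conj.prems(3) consider "\<chi> = simul_subst \<theta> (Conj \<psi>1 \<psi>2)" | "\<chi> \<in> cl_inst \<theta> \<psi>1" | "\<chi> \<in> cl_inst \<theta> \<psi>2"
    by auto
  then show ?case
  proof cases
    case 1
    then show ?thesis using simul_subst_in_cl_inst by simp
  next
    case 2
    then have "succs \<chi> \<subseteq> cl_inst \<theta> \<psi>1 \<union> B" by (intro Conj.IH(1)) (use Conj.prems in simp_all)
    then show ?thesis by auto
  next
    case 3
    then have "succs \<chi> \<subseteq> cl_inst \<theta> \<psi>2 \<union> B" by (intro Conj.IH(2)) (use Conj.prems in simp_all)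
    then show ?thesis by auto
  qed
next
  case (Disj \<psi>1 \<psi>2)
  from Disj.prems(3) consider "\<chi> = simul_subst \<theta> (Disj \<psi>1 \<psi>2)" | "\<chi> \<in> cl_inst \<theta> \<psi>1" | "\<chi> \<in> cl_inst \<theta> \<psi>2"
    by auto
  then show ?case
  proof cases
    case 1
    then show ?thesis using simul_subst_in_cl_inst by simp
  next
    case 2
    then have "succs \<chi> \<subseteq> cl_inst \<theta> \<psi>1 \<union> B" by (intro Disj.IH(1)) (use Disj.prems in simp_all)
    then show ?thesis by auto
  next
    case 3
    then have "succs \<chi> \<subseteq> cl_inst \<theta> \<psi>2 \<union> B" by (intro Disj.IH(2)) (use Disj.prems in simp_all)
    then show ?thesis by auto
  qed
next
  case (Dia \<sigma> \<psi>)
  from Dia.prems(3) consider "\<chi> = simul_subst \<theta> (Dia \<sigma> \<psi>)" | "\<chi> \<in> cl_inst \<theta> \<psi>"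
    by auto
  then show ?case
  proof cases
    case 1
    then show ?thesis using simul_subst_in_cl_inst by simp
  next
    case 2
    then have "succs \<chi> \<subseteq> cl_inst \<theta> \<psi> \<union> B" by (intro Dia.IH) (use Dia.prems in simp_all)
    then show ?thesis by auto
  qed
next
  case (Box \<sigma> \<psi>)
  from Box.prems(3) consider "\<chi> = simul_subst \<theta> (Box \<sigma> \<psi>)" | "\<chi> \<in> cl_inst \<theta> \<psi>"
    by auto
  then show ?case
  proof cases
    case 1
    then show ?thesis using simul_subst_in_cl_inst by simp
  next
    case 2
    then have "succs \<chi> \<subseteq> cl_inst \<theta> \<psi> \<union> B" by (intro Box.IH) (use Box.prems in simp_all)
    then show ?thesis by auto
  qed
next
  case (Mu X \<psi>)
  define \<mu> where "\<mu> = simul_subst \<theta> (Mu X \<psi>)"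
  define \<theta>' where "\<theta>' = \<theta>(X := \<mu>)"
  have "fv \<mu> \<subseteq> (\<Union>X\<in>fv (Mu X \<psi>). fv (\<theta> X))"
    unfolding \<mu>_def by (rule fv_simul_subst)
  then have "fv \<mu> = {}"
    using Mu.prems(1) by blast
  have "subst (simul_subst (\<theta>(X := FVar X)) \<psi>) X \<mu> = simul_subst \<theta>' \<psi>"
    unfolding \<theta>'_def by (rule subst_simul_subst) (use Mu.prems(1) in simp)
  then have succs_\<mu>: "succs \<mu> \<subseteq> cl_inst \<theta>' \<psi>"
    using simul_subst_in_cl_inst[of \<theta>' \<psi>] by (simp add: \<mu>_def)
  have cl: "cl_inst \<theta> (Mu X \<psi>) = insert \<mu> (cl_inst \<theta>' \<psi>)"
    by (simp add: \<mu>_def \<theta>'_def)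
  show ?case
  proof (cases "\<chi> = \<mu>")
    case True
    then show ?thesis using succs_\<mu> cl by auto
  next
    case False
    then have "\<chi> \<in> cl_inst \<theta>' \<psi>" using Mu.prems(3) cl by blast
    \<comment> \<open>The new variable stands for \<open>\<mu>\<close>, whose unfolding lies in the
      very set under consideration; so \<open>B\<close> is enlarged by that set, which is absorbed
      again afterwards.\<close>
    then have "succs \<chi> \<subseteq> cl_inst \<theta>' \<psi> \<union> (B \<union> cl_inst \<theta>' \<psi>)"
    proof (rule Mu.IH[rotated 2])
      fix Y assume "Y \<in> fv \<psi>"
      then show "fv (\<theta>' Y) = {}" "succs (\<theta>' Y) \<subseteq> B \<union> cl_inst \<theta>' \<psi>"
        using Mu.prems(1,2)[of Y] \<open>fv \<mu> = {}\<close> succs_\<mu> by (cases "Y = X"; auto simp: \<theta>'_def)+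
    qed
    then show ?thesis using cl by blast
  qed
qed auto

lemma finite_cl:
  assumes "closed_fml \<phi>"
  shows "finite (cl \<phi>)"
proof (rule finite_subset)
  show "cl \<phi> \<subseteq> cl_inst FVar \<phi>"
  proof (rule cl_least)
    show "\<phi> \<in> cl_inst FVar \<phi>"
      using simul_subst_in_cl_inst[of FVar \<phi>] by simp
    show "succs \<chi> \<subseteq> cl_inst FVar \<phi>" if "\<chi> \<in> cl_inst FVar \<phi>" for \<chi>
      using succs_cl_inst[of \<phi> FVar "{}" \<chi>] assms that by (simp add: closed_fml_def)
  qed
qed (rule finite_cl_inst)

lemma names_fml_cl: "\<psi> \<in> cl \<phi> \<Longrightarrow> names_fml \<psi> \<subseteq> names_fml \<phi>"
proof (induction rule: cl.induct)
  case (unfold X \<psi>)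
  then show ?case using names_fml_subst[of \<psi> X "Mu X \<psi>"] by auto
qed auto

section \<open>Renamed closure formulae and types of words\<close>

text \<open>Closing under renaming serves two purposes: it contains the formulae that bar modalities
  ask for under fresh names, and it makes the induced equivalence of words equivariant.\<close>

definition cl_perm :: "fml \<Rightarrow> fml set" where
  "cl_perm \<phi> = {perm_fml \<pi> \<psi> | \<pi> \<psi>. fperm \<pi> \<and> \<psi> \<in> cl \<phi>}"

lemma cl_perm_self: "\<phi> \<in> cl_perm \<phi>"
proof -
  have "\<phi> = perm_fml id \<phi>" by (simp only: perm_fml_id)
  then show ?thesis
    unfolding cl_perm_def using fperm_id cl.self by blast
qed

lemma cl_perm_perm:
  assumes "\<chi> \<in> cl_perm \<phi>" "fperm \<pi>"
  shows "perm_fml \<pi> \<chi> \<in> cl_perm \<phi>"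
proof -
  obtain \<sigma> \<psi> where "\<chi> = perm_fml \<sigma> \<psi>" "fperm \<sigma>" "\<psi> \<in> cl \<phi>"
    using assms(1) unfolding cl_perm_def by blast
  then have "perm_fml \<pi> \<chi> = perm_fml (\<pi> \<circ> \<sigma>) \<psi>" "fperm (\<pi> \<circ> \<sigma>)" "\<psi> \<in> cl \<phi>"
    using assms(2) by (simp_all only: perm_fml_comp fperm_comp)
  then show ?thesis
    unfolding cl_perm_def by blast
qed

lemma cl_perm_names:
  assumes "\<chi> \<in> cl_perm \<phi>"
  shows "card (names_fml \<chi>) \<le> card (names_fml \<phi>)"
proof -
  obtain \<sigma> \<psi> where *: "\<chi> = perm_fml \<sigma> \<psi>" "\<psi> \<in> cl \<phi>"
    using assms unfolding cl_perm_def by blast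
  have "card (names_fml \<chi>) \<le> card (names_fml \<psi>)"
    by (simp add: * card_image_le)
  also have "\<dots> \<le> card (names_fml \<phi>)"
    using names_fml_cl[OF *(2)] by (intro card_mono) simp_all
  finally show ?thesis .
qed

lemma cl_perm_succs:
  assumes "\<chi> \<in> cl_perm \<phi>" "\<chi>' \<in> succs \<chi>"
  shows "\<chi>' \<in> cl_perm \<phi>"
proof -
  obtain \<pi> \<psi> where \<chi>: "\<chi> = perm_fml \<pi> \<psi>" "fperm \<pi>" "\<psi> \<in> cl \<phi>"
    using assms(1) unfolding cl_perm_def by blast
  have "\<exists>\<psi>'\<in>succs \<psi>. \<chi>' = perm_fml \<pi> \<psi>'"
    using assms(2) unfolding \<chi>(1) by (cases \<psi>) (auto simp: perm_fml_subst)
  then obtain \<psi>' where \<psi>': "\<psi>' \<in> succs \<psi>" "\<chi>' = perm_fml \<pi> \<psi>'" ..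
  have "\<psi>' \<in> cl \<phi>"
    using \<psi>'(1) \<chi>(3) by (cases \<psi>) (auto intro: cl.intros)
  then show ?thesis
    unfolding cl_perm_def \<psi>'(2) using \<chi>(2) by blast
qed

lemma unfold_closed_cl_perm: "unfold_closed (cl_perm \<phi>)"
  unfolding unfold_closed_def
  by (intro conjI allI impI) (auto elim: cl_perm_succs)

section \<open>Truth of renamed closure formulae under prepending a letter\<close>

lemma sat_swp: "sat {} (perm_str (swp b c) v) \<chi> \<longleftrightarrow> sat {} v (perm_fml (swp b c) \<chi>)"
  using sat_perm_iff[OF fperm_swp, of "{}" b c "perm_str (swp b c) v" \<chi> "{}"]
  by (simp only: perm_str_comp swp_comp_swp perm_str_id)

text \<open>The congruence property behind the quotient. Only modal formulae inspect the first
  letter. In the bar case the tail is read after a swap, but \<open>sat_swp\<close> moves the swap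
  to the formula, which stays in \<open>cl_perm\<close>, so the hypothesis on the unswapped tails
  applies.\<close>

lemma sat_Cons_imp:
  assumes sub: "\<And>\<chi>. \<chi> \<in> cl_perm \<phi> \<Longrightarrow> sat {} v \<chi> \<Longrightarrow> sat {} w \<chi>"
    and "\<chi> \<in> cl_perm \<phi>" "sat {} (l # v) \<chi>"
  shows "sat {} (l # w) \<chi>"
proof (rule sat_modal_imp[OF unfold_closed_cl_perm _ _ _ assms(3,2)])
  have fresh: "\<exists>c. c \<notin> insert d (names_fml \<psi>) \<and> c \<notin> insert b (names_str v) \<and> c \<notin> insert b (names_str w)" for b d \<psi>
  proof -
    have "finite (insert d (names_fml \<psi>) \<union> insert b (names_str v) \<union> insert b (names_str w))" by simp
    then obtain c where "c \<notin> insert d (names_fml \<psi>) \<union> insert b (names_str v) \<union> insert b (names_str w)"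
      by (rule fresh_name)
    then show ?thesis by blast
  qed
  show "sat {} (l # w) (Dia \<sigma> \<psi>)" if prems: "Dia \<sigma> \<psi> \<in> cl_perm \<phi>" "sat {} (l # v) (Dia \<sigma> \<psi>)" for \<sigma> \<psi>
  proof -
    have \<psi>: "\<psi> \<in> cl_perm \<phi>" using prems(1) by (auto intro: cl_perm_succs)
    show ?thesis
    proof (cases \<sigma>)
      case (Plain d)
      then show ?thesis using prems(2) sub[OF \<psi>] by auto
    next
      case \<sigma>: (Bar d)
      then obtain b where l: "l = Bar b"
        using prems(2) sat_Bar_not_Bar(1) by (metis list.inject)
      obtain c where c: "c \<notin> insert d (names_fml \<psi>)" "c \<notin> insert b (names_str v)" "c \<notin> insert b (names_str w)"
        using fresh by blast
      have "perm_fml (swp b c) (perm_fml (swp d c) \<psi>) \<in> cl_perm \<phi>"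
        using \<psi> by (intro cl_perm_perm) simp_all
      from sub[OF this] show ?thesis
        using prems(2) unfolding \<sigma> l sat_Dia_Bar_fresh[OF c(1,2)] sat_Dia_Bar_fresh[OF c(1,3)] sat_swp .
    qed
  qed
  show "sat {} (l # w) (Box \<sigma> \<psi>)" if prems: "Box \<sigma> \<psi> \<in> cl_perm \<phi>" "sat {} (l # v) (Box \<sigma> \<psi>)" for \<sigma> \<psi>
  proof -
    have \<psi>: "\<psi> \<in> cl_perm \<phi>" using prems(1) by (auto intro: cl_perm_succs)
    show ?thesis
    proof (cases \<sigma>)
      case (Plain d)
      then show ?thesis using prems(2) sub[OF \<psi>] by auto
    next
      case \<sigma>: (Bar d)
      show ?thesis
      proof (cases l)
        case (Plain b)
        then show ?thesis by (simp add: \<sigma> sat_Bar_not_Bar)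
      next
        case l: (Bar b)
        obtain c where c: "c \<notin> insert d (names_fml \<psi>)" "c \<notin> insert b (names_str v)" "c \<notin> insert b (names_str w)"
          using fresh by blast
        have "perm_fml (swp b c) (perm_fml (swp d c) \<psi>) \<in> cl_perm \<phi>"
          using \<psi> by (intro cl_perm_perm) simp_all
        from sub[OF this] show ?thesis
          using prems(2) unfolding \<sigma> l sat_Box_Bar_fresh[OF c(1,2)] sat_Box_Bar_fresh[OF c(1,3)] sat_swp .
      qed
    qed
  qed
qed simp

section \<open>Free names of suffixes\<close>

fun narrow :: "nat \<Rightarrow> bl list \<Rightarrow> bool" where
  "narrow n [] = True"
| "narrow n (l # v) = (card (fn_str (l # v)) \<le> n \<and> narrow n v)"

text \<open>Suffixes are what is left at the moments of a run, so both predicates look at all of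
  them. They are used as \<open>narrow (Suc n)\<close> and \<open>wide n\<close>, which overlap on
  purpose.\<close>

fun wide :: "nat \<Rightarrow> bl list \<Rightarrow> bool" where
  "wide n [] = False"
| "wide n (l # v) = (n < card (fn_str (l # v)) \<or> wide n v)"

lemma narrow_card: "narrow n v \<Longrightarrow> card (fn_str v) \<le> n"
  by (cases v) auto

lemma card_fn_str_Cons_perm:
  assumes "fperm \<pi>"
  shows "card (fn_str (perm_bl \<pi> l # perm_str \<pi> v)) = card (fn_str (l # v))"
  by (simp only: fn_str_Cons_perm[OF fperm_inj[OF assms]] card_image[OF inj_on_subset[OF fperm_inj[OF assms] subset_UNIV]])

lemma narrow_perm: "fperm \<pi> \<Longrightarrow> narrow n (perm_str \<pi> v) = narrow n v"
  by (induction v) (simp_all only: perm_str_simps narrow.simps card_fn_str_Cons_perm)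

lemma wide_perm: "fperm \<pi> \<Longrightarrow> wide n (perm_str \<pi> v) = wide n v"
  by (induction v) (simp_all only: perm_str_simps wide.simps card_fn_str_Cons_perm)

lemma card_fn_str_snoc: "card (fn_str (w @ [l])) \<le> Suc (card (fn_str w))"
proof -
  have "fn_str (w @ [l]) \<subseteq> insert (bl_name l) (fn_str w)"
    by (induction w rule: fn_str.induct) (cases l; auto)+
  then have "card (fn_str (w @ [l])) \<le> card (insert (bl_name l) (fn_str w))"
    by (intro card_mono) simp_all
  also have "\<dots> \<le> Suc (card (fn_str w))"
    by (rule card_insert_le_m1) simp_all
  finally show ?thesis .
qed

lemma narrow_snoc: "\<not> wide n w \<Longrightarrow> narrow (Suc n) (w @ [l])"
proof (induction w)
  case Nil
  then show ?case using card_fn_str_snoc[of "[]" l] by simp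
next
  case (Cons l' w)
  then show ?case using card_fn_str_snoc[of "l' # w" l] by simp
qed

text \<open>One further letter adds at most one free name to each suffix. Hence the prefix just
  before the bound \<open>Suc n\<close> breaks is already wide for \<open>n\<close>, while still
  being narrow enough to be a state.\<close>

lemma wide_narrow_prefix:
  assumes "\<not> narrow (Suc n) w"
  obtains v u where "w = v @ u" "narrow (Suc n) v" "wide n v"
proof -
  have "\<exists>v u. w = v @ u \<and> narrow (Suc n) v \<and> wide n v"
    using assms
  proof (induction w rule: rev_induct)
    case (snoc l w)
    then show ?case using narrow_snoc by (metis append_assoc)
  qed simp
  then show thesis using that by blast
qed

text \<open>Letters are stripped by \<open>sat_Cons_imp\<close> until the suffix responsible for
  wideness is at the front. It has more free names than \<open>\<chi>\<close> has names, so one of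
  them is not mentioned by \<open>\<chi>\<close> and \<open>sat_append_imp\<close> applies.\<close>

lemma sat_wide_append_imp:
  assumes "wide (card (names_fml \<phi>)) v" "\<chi> \<in> cl_perm \<phi>" "sat {} (v @ u) \<chi>"
  shows "sat {} (v @ u') \<chi>"
  using assms
proof (induction v arbitrary: \<chi>)
  case (Cons l v)
  show ?case
  proof (cases "wide (card (names_fml \<phi>)) v")
    case True
    have "sat {} (l # (v @ u')) \<chi>"
    proof (rule sat_Cons_imp)
      show "sat {} (v @ u') \<psi>" if "\<psi> \<in> cl_perm \<phi>" "sat {} (v @ u) \<psi>" for \<psi>
        using Cons.IH True that by blast
      show "sat {} (l # (v @ u)) \<chi>" using Cons.prems(3) by simp
    qed (rule Cons.prems(2))
    then show ?thesis by simp
  next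
    case False
    then have "card (names_fml \<phi>) < card (fn_str (l # v))"
      using Cons.prems(1) by simp
    moreover have "card (fn_fml \<chi>) \<le> card (names_fml \<chi>)"
      by (intro card_mono fn_fml_names) simp
    ultimately have "card (fn_fml \<chi>) < card (fn_str (l # v))"
      using cl_perm_names[OF Cons.prems(2)] by linarith
    moreover have "finite (fn_fml \<chi>)"
      by (rule finite_subset[OF fn_fml_names finite_names_fml])
    ultimately have "\<not> fn_str (l # v) \<subseteq> fn_fml \<chi>"
      by (meson card_mono not_le)
    then obtain a where "a \<in> fn_str (l # v)" "a \<notin> fn_fml \<chi>" by blast
    then show ?thesis
      using Cons.prems(3) by (rule sat_append_imp)
  qed
qed simp

section \<open>The automaton of a formula\<close>

instance bl :: countable
  by countable_datatype

text \<open>In a state \<open>(v, e)\<close> the automaton still has to read \<open>v\<close>, after which the input ends or,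
  if \<open>e\<close> is set, continues arbitrarily; \<^const>\<open>None\<close> is the initial state.\<close>

type_synonym pre_state = "(bl list \<times> bool) option"

text \<open>Emptiness decides acceptance, the free names pin down the support, and the wideness flag
  lets a run verify that stopping early was justified. Narrowness is deliberately not recorded: it
  only restricts which classes become states.\<close>

definition key :: "fml \<Rightarrow> pre_state \<Rightarrow> (bool \<times> bool \<times> nat set \<times> bool \<times> fml set) option" where
  "key \<phi> = map_option (\<lambda>(v, e). (e, v = [], fn_str v, wide (card (names_fml \<phi>)) v,
     {\<chi> \<in> cl_perm \<phi>. sat {} v \<chi>}))"

text \<open>Keys contain sets of formulae and so range over an uncountable type. Encoding a chosen
  representative word of the class instead gives states that are natural numbers.\<close>

definition state :: "fml \<Rightarrow> pre_state \<Rightarrow> nat" where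
  "state \<phi> x = to_nat (inv (key \<phi>) (key \<phi> x))"

lemma state_eq_iff: "state \<phi> x = state \<phi> y \<longleftrightarrow> key \<phi> x = key \<phi> y"
  unfolding state_def by (metis f_inv_into_f from_nat_to_nat rangeI)

definition rename :: "(nat \<Rightarrow> nat) \<Rightarrow> pre_state \<Rightarrow> pre_state" where
  "rename \<pi> = map_option (map_prod (perm_str \<pi>) id)"

text \<open>Acts on an arbitrary representative; independence of the choice is the content of
  \<open>st_perm\<close> and is packaged in \<open>act_st\<close>.\<close>

definition state_act :: "fml \<Rightarrow> (nat \<Rightarrow> nat) \<Rightarrow> nat \<Rightarrow> nat" where
  "state_act \<phi> \<pi> q = state \<phi> (rename \<pi> (SOME x. state \<phi> x = q))"

locale formula_automaton =
  fixes \<phi> :: fml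
  assumes closed: "closed_fml \<phi>"
begin

definition width :: nat where
  "width = card (names_fml \<phi>)"

definition init :: nat where
  "init = state \<phi> None"

definition st :: "bl list \<Rightarrow> bool \<Rightarrow> nat" where
  "st v e = state \<phi> (Some (v, e))"

definition states :: "nat set" where
  "states = insert init {st v e | v e. narrow (Suc width) v}"

text \<open>A letter may be read from a class as soon as some narrow member starts with it. The
  initial guess may set the flag for arbitrary continuation only on a wide word, where the
  continuation cannot matter.\<close>

definition aut :: "nat ernna" where
  "aut = \<lparr>Qs = states, pact = state_act \<phi>,
     delta = {(init, None, st v e) | v e.
         fn_str v = {} \<and> narrow (Suc width) v \<and> sat {} v \<phi> \<and> (e \<longrightarrow> wide width v)} \<union>
       {(st (l # v) e, Some l, st v e) | l v e. narrow (Suc width) (l # v)},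
     s0 = init,
     fa = (\<lambda>q. if q = st [] False then Acc1 else if q = st [] True then AccTop else Acc0)\<rparr>"

section \<open>The quotient map, the permutation action and supports\<close>

lemma st_eq_iff:
  "st v e = st w f \<longleftrightarrow> e = f \<and> (v = [] \<longleftrightarrow> w = []) \<and> fn_str v = fn_str w \<and>
     (wide width v \<longleftrightarrow> wide width w) \<and> (\<forall>\<chi>\<in>cl_perm \<phi>. sat {} v \<chi> \<longleftrightarrow> sat {} w \<chi>)"
proof -
  have "{\<chi> \<in> cl_perm \<phi>. sat {} v \<chi>} = {\<chi> \<in> cl_perm \<phi>. sat {} w \<chi>} \<longleftrightarrow>
      (\<forall>\<chi>\<in>cl_perm \<phi>. sat {} v \<chi> \<longleftrightarrow> sat {} w \<chi>)"
    by blast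
  then show ?thesis
    by (simp add: st_def state_eq_iff key_def width_def)
qed

lemma st_neq_init [simp]: "st v e \<noteq> init" "init \<noteq> st v e"
  by (simp_all add: st_def init_def state_eq_iff key_def)

lemma st_Cons:
  assumes "st v e = st w f"
  shows "st (l # v) e = st (l # w) f"
proof -
  have *: "e = f" "fn_str v = fn_str w" "wide width v \<longleftrightarrow> wide width w"
    "\<And>\<chi>. \<chi> \<in> cl_perm \<phi> \<Longrightarrow> sat {} v \<chi> \<longleftrightarrow> sat {} w \<chi>"
    using assms unfolding st_eq_iff by blast+
  have fn: "fn_str (l # v) = fn_str (l # w)"
    using *(2) by (rule fn_str_Cons_cong)
  have "sat {} (l # v) \<chi> \<longleftrightarrow> sat {} (l # w) \<chi>" if "\<chi> \<in> cl_perm \<phi>" for \<chi>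
    using sat_Cons_imp[of \<phi> v w \<chi> l] sat_Cons_imp[of \<phi> w v \<chi> l] *(4) that by blast
  then show ?thesis
    unfolding st_eq_iff wide.simps fn using * by simp
qed

lemma st_perm:
  assumes "st v e = st w f" "fperm \<pi>"
  shows "st (perm_str \<pi> v) e = st (perm_str \<pi> w) f"
proof -
  have *: "e = f" "v = [] \<longleftrightarrow> w = []" "fn_str v = fn_str w" "wide width v \<longleftrightarrow> wide width w"
    "\<And>\<chi>. \<chi> \<in> cl_perm \<phi> \<Longrightarrow> sat {} v \<chi> \<longleftrightarrow> sat {} w \<chi>"
    using assms unfolding st_eq_iff by blast+
  have "sat {} (perm_str \<pi> v) \<chi> \<longleftrightarrow> sat {} (perm_str \<pi> w) \<chi>" if "\<chi> \<in> cl_perm \<phi>" for \<chi>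
  proof -
    have "perm_fml (inv \<pi>) \<chi> \<in> cl_perm \<phi>"
      using that assms(2) by (intro cl_perm_perm fperm_inv)
    then have "sat {} v (perm_fml (inv \<pi>) \<chi>) \<longleftrightarrow> sat {} w (perm_fml (inv \<pi>) \<chi>)"
      by (rule *(5))
    then show ?thesis
      using sat_perm_iff[OF assms(2), of "{}" _ "perm_fml (inv \<pi>) \<chi>" "{}"]
      by (simp only: perm_fml_inv[OF assms(2)])
  qed
  then show ?thesis
    unfolding st_eq_iff using * by (simp add: fn_str_perm fperm_inj assms(2) wide_perm)
qed

lemma st_perm_cong:
  assumes "fperm \<pi>" "fperm \<sigma>" "\<And>a. a \<in> fn_str v \<Longrightarrow> \<pi> a = \<sigma> a"
  shows "st (perm_str \<pi> v) e = st (perm_str \<sigma> v) e"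
proof -
  have "\<pi> ` fn_str v = \<sigma> ` fn_str v"
    using assms(3) by (rule image_cong[OF refl])
  then show ?thesis
    unfolding st_eq_iff using sat_perm_cong[OF assms]
    by (simp add: fn_str_perm fperm_inj assms(1,2) wide_perm)
qed

text \<open>Every component of the key is alpha-invariant. This is the source of the closure of bar
  transitions under renaming the bound name.\<close>

lemma st_Bar_swp:
  assumes "b \<notin> fn_str (Bar a # v)"
  shows "st (Bar b # perm_str (swp a b) v) e = st (Bar a # v) e"
  unfolding st_eq_iff wide.simps fn_str_Bar_swp[OF assms] wide_perm[OF fperm_swp]
  using sat_alpha_eq[OF alpha_eq_Bar_swp[OF assms]] by simp

lemma act_st [simp]:
  assumes "fperm \<pi>"
  shows "state_act \<phi> \<pi> (st v e) = st (perm_str \<pi> v) e"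
proof -
  define x where "x = (SOME x. state \<phi> x = st v e)"
  have "state \<phi> x = st v e"
    unfolding x_def by (rule someI[of _ "Some (v, e)"]) (simp add: st_def)
  moreover from this obtain w f where x: "x = Some (w, f)"
    by (cases x) (auto simp: st_def state_eq_iff key_def)
  ultimately have "st w f = st v e" by (simp add: st_def)
  then have "st (perm_str \<pi> w) f = st (perm_str \<pi> v) e"
    using assms by (rule st_perm)
  then show ?thesis
    unfolding state_act_def x_def[symmetric] by (simp add: x rename_def st_def)
qed

lemma act_init [simp]: "state_act \<phi> \<pi> init = init"
proof -
  define x where "x = (SOME x. state \<phi> x = init)"
  have "state \<phi> x = init"
    unfolding x_def by (rule someI[of _ None]) (simp add: init_def)
  then have "x = None"
    by (cases x) (auto simp: init_def state_eq_iff key_def)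
  then show ?thesis
    unfolding state_act_def x_def[symmetric] by (simp add: rename_def init_def)
qed

lemma supports_st: "supports (state_act \<phi>) (fn_str v) (st v e)"
  unfolding supports_def
proof (intro allI impI)
  fix \<pi> assume \<pi>: "fperm \<pi> \<and> (\<forall>a\<in>fn_str v. \<pi> a = a)"
  then have "st (perm_str \<pi> v) e = st (perm_str id v) e"
    by (intro st_perm_cong) simp_all
  then show "state_act \<phi> \<pi> (st v e) = st v e" using \<pi> by (simp only: act_st perm_str_id)
qed

text \<open>Exactness comes from the free names being part of the key: exchanging a free name
  outside a supposed support with a fresh one would change them.\<close>

lemma supp_st [simp]: "supp (state_act \<phi>) (st v e) = fn_str v"
proof
  show "supp (state_act \<phi>) (st v e) \<subseteq> fn_str v"
    unfolding supp_def using supports_st finite_fn_str by blast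
  show "fn_str v \<subseteq> supp (state_act \<phi>) (st v e)"
    unfolding supp_def
  proof (intro subsetI InterI)
    fix a S assume a: "a \<in> fn_str v" and "S \<in> {S. finite S \<and> supports (state_act \<phi>) S (st v e)}"
    then have S: "finite S" "supports (state_act \<phi>) S (st v e)" by simp_all
    show "a \<in> S"
    proof (rule ccontr)
      assume "a \<notin> S"
      have "finite (S \<union> fn_str v)" using S by simp
      then obtain b where b: "b \<notin> S \<union> fn_str v" by (rule fresh_name)
      have "\<forall>c\<in>S. swp a b c = c"
        using b \<open>a \<notin> S\<close> by (auto simp: swp_def)
      then have "state_act \<phi> (swp a b) (st v e) = st v e"
        using S(2) unfolding supports_def by simp
      then have "fn_str (perm_str (swp a b) v) = fn_str v"
        by (simp add: st_eq_iff)
      moreover have "b \<in> swp a b ` fn_str v"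
        using a by (intro image_eqI[of _ _ a]) simp_all
      ultimately show False using b by (simp add: fn_str_perm fperm_inj)
    qed
  qed
qed

lemma supp_init [simp]: "supp (state_act \<phi>) init = {}"
  unfolding supp_def supports_def by auto

lemma states_cases:
  assumes "q \<in> states"
  obtains "q = init" | v e where "q = st v e" "narrow (Suc width) v"
proof -
  have "q = init \<or> (\<exists>v e. q = st v e \<and> narrow (Suc width) v)"
    using assms unfolding states_def by simp
  then show thesis using that by blast
qed

sublocale name_action states "state_act \<phi>" "supp (state_act \<phi>)"
proof
  fix q \<pi> assume q: "q \<in> states"
  show "state_act \<phi> id q = q"
    using q by (rule states_cases) (simp_all only: act_init act_st fperm_id perm_str_id)
  show "finite (supp (state_act \<phi>) q)"
    using q by (rule states_cases) simp_all
  assume \<pi>: "fperm \<pi>"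
  show "state_act \<phi> \<pi> q \<in> states"
    using q
  proof (rule states_cases)
    fix v e assume "q = st v e" "narrow (Suc width) v"
    then have "state_act \<phi> \<pi> q = st (perm_str \<pi> v) e" "narrow (Suc width) (perm_str \<pi> v)"
      using \<pi> by (simp_all only: act_st narrow_perm)
    then show ?thesis unfolding states_def by blast
  qed (simp add: states_def)
  show "supp (state_act \<phi>) (state_act \<phi> \<pi> q) = \<pi> ` supp (state_act \<phi>) q"
    using q by (rule states_cases) (simp_all add: \<pi> fn_str_perm fperm_inj)
  fix \<sigma> assume \<sigma>: "fperm \<sigma>"
  show "state_act \<phi> \<pi> (state_act \<phi> \<sigma> q) = state_act \<phi> (\<pi> \<circ> \<sigma>) q"
    using q by (rule states_cases) (simp_all only: act_init act_st \<pi> \<sigma> fperm_comp perm_str_comp)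
  assume "\<And>a. a \<in> supp (state_act \<phi>) q \<Longrightarrow> \<pi> a = \<sigma> a"
  note agree = this
  show "state_act \<phi> \<pi> q = state_act \<phi> \<sigma> q"
    using q
  proof (rule states_cases)
    fix v e assume "q = st v e"
    then show ?thesis
      using agree by (simp only: act_st \<pi> \<sigma> supp_st st_perm_cong)
  qed (simp only: act_init)
qed

subsection \<open>Counting states\<close>

text \<open>A renamed formula is determined by a closure formula and a map from the at most
  \<open>width\<close> original names into \<open>S\<close>; such maps may be counted without asking
  for injectivity.\<close>

lemma card_cl_perm_names:
  assumes "finite S" "S \<noteq> {}"
  defines "F \<equiv> {\<chi> \<in> cl_perm \<phi>. names_fml \<chi> \<subseteq> S}"
  shows "finite F" "card F \<le> card (cl \<phi>) * card S ^ width"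
proof -
  let ?P = "names_fml \<phi> \<rightarrow>\<^sub>E S"
  have sub: "F \<subseteq> (\<lambda>(\<psi>, h). perm_fml h \<psi>) ` (cl \<phi> \<times> ?P)"
  proof
    fix \<chi> assume "\<chi> \<in> F"
    then obtain \<pi> \<psi> where \<chi>: "\<chi> = perm_fml \<pi> \<psi>" "\<psi> \<in> cl \<phi>" and S: "names_fml \<chi> \<subseteq> S"
      unfolding F_def cl_perm_def by blast
    obtain s where s: "s \<in> S" using assms(2) by blast
    \<comment> \<open>Names of \<open>\<phi>\<close> that do not occur in \<open>\<psi>\<close> get
      the default value \<open>s\<close>, so that the map takes values in \<open>S\<close>.\<close>
    define h where "h = (\<lambda>x\<in>names_fml \<phi>. if x \<in> names_fml \<psi> then \<pi> x else s)"
    have "\<pi> x \<in> S" if "x \<in> names_fml \<psi>" for x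
      using S that unfolding \<chi>(1) names_fml_perm by blast
    then have "h \<in> ?P"
      using s by (simp add: h_def restrict_PiE_iff)
    moreover have "perm_fml h \<psi> = \<chi>"
      unfolding \<chi>(1) by (rule perm_fml_cong) (use names_fml_cl[OF \<chi>(2)] in \<open>auto simp: h_def\<close>)
    ultimately show "\<chi> \<in> (\<lambda>(\<psi>, h). perm_fml h \<psi>) ` (cl \<phi> \<times> ?P)"
      using \<chi>(2) by (intro image_eqI[of _ _ "(\<psi>, h)"]) simp_all
  qed
  have fin: "finite (cl \<phi> \<times> ?P)"
    using finite_cl[OF closed] assms(1) by (intro finite_cartesian_product finite_PiE) simp_all
  from finite_subset[OF sub] fin show "finite F" by blast
  have "card F \<le> card (cl \<phi> \<times> ?P)"
    using fin sub by (rule surj_card_le)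
  also have "\<dots> = card (cl \<phi>) * card S ^ width"
    by (simp add: card_cartesian_product card_PiE width_def)
  finally show "card F \<le> card (cl \<phi>) * card S ^ width" .
qed

text \<open>A formula has at most \<open>width\<close> names, so those outside \<open>S\<close> fit
  injectively into \<open>S' - S\<close>. A permutation doing this and fixing \<open>S\<close>
  leaves the truth values on \<open>v\<close> and \<open>w\<close> unchanged, which reduces the
  infinite family to formulae over \<open>S'\<close>.\<close>

lemma st_eqI_names:
  assumes "finite S'" "S \<subseteq> S'" "width \<le> card (S' - S)" "fn_str v \<subseteq> S" "fn_str w \<subseteq> S"
    and "e = f" "v = [] \<longleftrightarrow> w = []" "wide width v \<longleftrightarrow> wide width w" "fn_str v = fn_str w"
    and same: "\<And>\<chi>. \<chi> \<in> cl_perm \<phi> \<Longrightarrow> names_fml \<chi> \<subseteq> S' \<Longrightarrow> sat {} v \<chi> \<longleftrightarrow> sat {} w \<chi>"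
  shows "st v e = st w f"
proof -
  have "sat {} v \<chi> \<longleftrightarrow> sat {} w \<chi>" if \<chi>: "\<chi> \<in> cl_perm \<phi>" for \<chi>
  proof -
    have "card (names_fml \<chi> - S) \<le> card (names_fml \<chi>)"
      by (intro card_mono) auto
    also have "\<dots> \<le> width"
      using cl_perm_names[OF \<chi>] by (simp add: width_def)
    finally have "card (names_fml \<chi> - S) \<le> card (S' - S)"
      using assms(3) by simp
    then obtain g where g: "g ` (names_fml \<chi> - S) \<subseteq> S' - S" "inj_on g (names_fml \<chi> - S)"
      using card_le_inj[of "names_fml \<chi> - S" "S' - S"] assms(1) by auto
    define h where "h x = (if x \<in> S then x else g x)" for x
    have "inj_on h (S \<union> names_fml \<chi>)"
    proof (rule inj_onI)
      fix x y assume *: "x \<in> S \<union> names_fml \<chi>" "y \<in> S \<union> names_fml \<chi>" "h x = h y"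
      show "x = y"
      proof (cases "x \<in> S \<longleftrightarrow> y \<in> S")
        case True
        then show ?thesis using * g(2) unfolding h_def by (auto dest: inj_onD)
      next
        case False
        then have "x \<in> S \<and> y \<in> names_fml \<chi> - S \<or> y \<in> S \<and> x \<in> names_fml \<chi> - S"
          using * by blast
        then show ?thesis using *(3) g(1) unfolding h_def by auto
      qed
    qed
    moreover have "finite (S \<union> names_fml \<chi>)"
      using assms(1,2) by (simp add: finite_subset)
    ultimately obtain \<pi> where \<pi>: "fperm \<pi>" "\<And>x. x \<in> S \<union> names_fml \<chi> \<Longrightarrow> \<pi> x = h x"
      using fperm_extends_inj_on by metis
    have "\<pi> x = id x" if "x \<in> S" for x
      using \<pi>(2)[of x] that by (simp add: h_def)
    then have "sat {} (perm_str \<pi> u) \<psi> \<longleftrightarrow> sat {} (perm_str id u) \<psi>" if "fn_str u \<subseteq> S" for u \<psi>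
      using that by (intro sat_perm_cong \<pi>(1) fperm_id) blast
    then have stable: "sat {} (perm_str \<pi> u) \<psi> \<longleftrightarrow> sat {} u \<psi>" if "fn_str u \<subseteq> S" for u \<psi>
      using that by (simp only: perm_str_id)
    have "names_fml (perm_fml \<pi> \<chi>) \<subseteq> S'"
    proof -
      have "\<pi> x \<in> S'" if "x \<in> names_fml \<chi>" for x
        using \<pi>(2)[of x] that g(1) assms(2) by (cases "x \<in> S") (auto simp: h_def)
      then show ?thesis by auto
    qed
    then have "sat {} v (perm_fml \<pi> \<chi>) \<longleftrightarrow> sat {} w (perm_fml \<pi> \<chi>)"
      using \<chi> \<pi>(1) by (intro same cl_perm_perm)
    then have "sat {} (perm_str \<pi> v) (perm_fml \<pi> \<chi>) \<longleftrightarrow> sat {} (perm_str \<pi> w) (perm_fml \<pi> \<chi>)"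
      by (simp only: stable[OF assms(4)] stable[OF assms(5)])
    then show ?thesis
      by (simp only: sat_perm_iff[OF \<pi>(1), of "{}" _ _ "{}"])
  qed
  then show ?thesis
    unfolding st_eq_iff using assms(6-9) by blast
qed

text \<open>The factor 8 accounts for the three flags (end mode, emptiness, wideness), the next for
  the set of free names, and the last for the truth values of formulae over
  \<open>S'\<close>.\<close>

lemma card_states_fn_str:
  assumes "finite S'" "S' \<noteq> {}" "S \<subseteq> S'" "width \<le> card (S' - S)"
  defines "X \<equiv> {st v e | v e. fn_str v \<subseteq> S}"
  shows "finite X" "card X \<le> 8 * 2 ^ card S * 2 ^ (card (cl \<phi>) * card S' ^ width)"
proof -
  define F where "F = {\<chi> \<in> cl_perm \<phi>. names_fml \<chi> \<subseteq> S'}"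
  define sig where
    "sig = (\<lambda>(v, e :: bool). (e, v = [], wide width v, fn_str v, {\<chi> \<in> F. sat {} v \<chi>}))"
  define V where "V = {(v, e :: bool) | v e. fn_str v \<subseteq> S}"
  define T where "T = (UNIV :: bool set) \<times> (UNIV :: bool set) \<times> (UNIV :: bool set) \<times> Pow S \<times> Pow F"
  have F: "finite F" "card F \<le> card (cl \<phi>) * card S' ^ width"
    using card_cl_perm_names[OF assms(1,2)] by (simp_all add: F_def)
  have "finite S" using assms(1,3) by (rule rev_finite_subset)
  then have "finite T" using F(1) by (simp add: T_def)
  define g where "g = (\<lambda>(v, e). st v e)"
  have X: "X = g ` V"
    unfolding X_def V_def g_def by auto
  have "sig x \<in> T" if "x \<in> V" for x
    using that by (cases x) (auto simp: V_def sig_def T_def)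
  then have sigV: "sig ` V \<subseteq> T" by blast
  have eq: "g x = g y" if "x \<in> V" "y \<in> V" "sig x = sig y" for x y
  proof -
    obtain v e where x: "x = (v, e)" by (cases x)
    obtain w f where y: "y = (w, f)" by (cases y)
    have V: "fn_str v \<subseteq> S" "fn_str w \<subseteq> S"
      using that(1,2) by (simp_all add: x y V_def)
    have *: "e = f" "(v = []) = (w = [])" "wide width v = wide width w" "fn_str v = fn_str w"
      "{\<chi> \<in> F. sat {} v \<chi>} = {\<chi> \<in> F. sat {} w \<chi>}"
      using that(3) unfolding x y sig_def prod.case prod.inject by blast+
    have "sat {} v \<chi> \<longleftrightarrow> sat {} w \<chi>" if "\<chi> \<in> cl_perm \<phi>" "names_fml \<chi> \<subseteq> S'" for \<chi>
      using *(5) that unfolding F_def by blast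
    then have "st v e = st w f"
      by (rule st_eqI_names[OF assms(1,3,4) V *(1-4)])
    then show ?thesis by (simp add: x y g_def)
  qed
  have sub: "X \<subseteq> (\<lambda>t. g (SOME x. x \<in> V \<and> sig x = t)) ` T"
  proof
    fix q assume "q \<in> X"
    then obtain x where x: "x \<in> V" "q = g x" unfolding X by (rule imageE)
    define y where "y = (SOME y. y \<in> V \<and> sig y = sig x)"
    have "y \<in> V \<and> sig y = sig x"
      unfolding y_def by (rule someI[of _ x]) (simp add: x)
    then have "q = g y"
      unfolding x(2) using x(1) by (intro eq) simp_all
    moreover have "sig x \<in> T" using sigV x(1) by blast
    ultimately show "q \<in> (\<lambda>t. g (SOME x. x \<in> V \<and> sig x = t)) ` T"
      unfolding y_def by (intro image_eqI)
  qed
  show "finite X" using \<open>finite T\<close> sub by (rule finite_surj)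
  have "card X \<le> card T"
    using \<open>finite T\<close> sub by (rule surj_card_le)
  also have "\<dots> = 8 * 2 ^ card S * 2 ^ card F"
    using \<open>finite S\<close> F(1) by (simp add: T_def card_cartesian_product card_Pow)
  also have "\<dots> \<le> 8 * 2 ^ card S * 2 ^ (card (cl \<phi>) * card S' ^ width)"
    using F(2) by simp
  finally show "card X \<le> 8 * 2 ^ card S * 2 ^ (card (cl \<phi>) * card S' ^ width)" .
qed

lemma finite_states_fn_str:
  assumes "finite S"
  shows "finite {st v e | v e. fn_str v \<subseteq> S}"
proof -
  have "infinite (UNIV - S)"
    using assms by simp
  \<comment> \<open>One name more than \<open>width\<close> keeps the pool nonempty even if both
    \<open>width\<close> and \<open>S\<close> are trivial.\<close>
  then obtain Y where Y: "Y \<subseteq> UNIV - S" "finite Y" "card Y = Suc width"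
    using infinite_arbitrarily_large by blast
  then have "S \<union> Y - S = Y" by blast
  then show ?thesis
    using Y assms by (intro card_states_fn_str(1)[of "S \<union> Y"]) auto
qed

lemma orbit_act:
  assumes "q \<in> states" "fperm \<pi>"
  shows "orbit (state_act \<phi>) (state_act \<phi> \<pi> q) = orbit (state_act \<phi>) q"
proof
  show "orbit (state_act \<phi>) (state_act \<phi> \<pi> q) \<subseteq> orbit (state_act \<phi>) q"
  proof
    fix x assume "x \<in> orbit (state_act \<phi>) (state_act \<phi> \<pi> q)"
    then obtain \<sigma> where "x = state_act \<phi> \<sigma> (state_act \<phi> \<pi> q)" "fperm \<sigma>"
      unfolding orbit_def by blast
    then have "x = state_act \<phi> (\<sigma> \<circ> \<pi>) q" "fperm (\<sigma> \<circ> \<pi>)"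
      using assms by (simp_all only: act_comp fperm_comp)
    then show "x \<in> orbit (state_act \<phi>) q" unfolding orbit_def by blast
  qed
  show "orbit (state_act \<phi>) q \<subseteq> orbit (state_act \<phi>) (state_act \<phi> \<pi> q)"
  proof
    fix x assume "x \<in> orbit (state_act \<phi>) q"
    then obtain \<sigma> where \<sigma>: "x = state_act \<phi> \<sigma> q" "fperm \<sigma>"
      unfolding orbit_def by blast
    have "\<sigma> \<circ> inv \<pi> \<circ> \<pi> = \<sigma>"
      using assms(2) by (simp only: comp_assoc inv_comp_fperm comp_id)
    then have "x = state_act \<phi> (\<sigma> \<circ> inv \<pi>) (state_act \<phi> \<pi> q)" "fperm (\<sigma> \<circ> inv \<pi>)"
      using assms \<sigma> by (simp_all only: act_comp fperm_comp fperm_inv)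
    then show "x \<in> orbit (state_act \<phi>) (state_act \<phi> \<pi> q)" unfolding orbit_def by blast
  qed
qed

text \<open>Narrow words have at most \<open>width + 1\<close> free names, so every orbit other than
  that of \<open>init\<close> meets the states over the first \<open>width + 1\<close> names. Adding
  \<open>width\<close> spare names gives the base \<open>2 * width + 1\<close>; the outer
  \<open>Suc\<close> counts \<open>init\<close>.\<close>

lemma card_orbits:
  shows "finite (orbits states (state_act \<phi>))"
    and "card (orbits states (state_act \<phi>)) \<le>
      Suc (8 * 2 ^ Suc width * 2 ^ (card (cl \<phi>) * (2 * width + 1) ^ width))"
proof -
  define X where "X = {st v e | v e. fn_str v \<subseteq> {..<Suc width}}"
  have "{..<2 * width + 1} - {..<Suc width} = {Suc width..<2 * width + 1}" by auto
  then have S: "finite {..<2 * width + 1}" "{..<2 * width + 1} \<noteq> {}" "{..<Suc width} \<subseteq> {..<2 * width + 1}"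
    "width \<le> card ({..<2 * width + 1} - {..<Suc width})"
    by (simp_all add: lessThan_empty_iff)
  have X: "finite X" "card X \<le> 8 * 2 ^ Suc width * 2 ^ (card (cl \<phi>) * (2 * width + 1) ^ width)"
    using card_states_fn_str[OF S] unfolding X_def card_lessThan by blast+
  have sub: "orbits states (state_act \<phi>) \<subseteq> orbit (state_act \<phi>) ` insert init X"
  proof
    fix O' assume "O' \<in> orbits states (state_act \<phi>)"
    then obtain q where q: "q \<in> states" "O' = orbit (state_act \<phi>) q"
      unfolding orbits_def by blast
    from q(1) show "O' \<in> orbit (state_act \<phi>) ` insert init X"
    proof (rule states_cases)
      fix v e assume v: "q = st v e" "narrow (Suc width) v"
      have "card (fn_str v) \<le> card {..<Suc width}"
        using narrow_card[OF v(2)] by simp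
      then obtain g where g: "g ` fn_str v \<subseteq> {..<Suc width}" "inj_on g (fn_str v)"
        using card_le_inj[of "fn_str v" "{..<Suc width}"] by auto
      obtain \<pi> where \<pi>: "fperm \<pi>" "\<And>x. x \<in> fn_str v \<Longrightarrow> \<pi> x = g x"
        using fperm_extends_inj_on[OF finite_fn_str g(2)] by metis
      have "fn_str (perm_str \<pi> v) \<subseteq> {..<Suc width}"
        using g(1) \<pi>(2) by (auto simp: fn_str_perm fperm_inj \<pi>(1))
      then have "state_act \<phi> \<pi> q \<in> X"
        unfolding v(1) act_st[OF \<pi>(1)] X_def by blast
      moreover have "O' = orbit (state_act \<phi>) (state_act \<phi> \<pi> q)"
        using orbit_act[OF q(1) \<pi>(1)] q(2) by simp
      ultimately show ?thesis by blast
    qed (use q in blast)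
  qed
  have fin: "finite (insert init X)" using X(1) by simp
  then show "finite (orbits states (state_act \<phi>))"
    using sub finite_surj by blast
  have "card (orbits states (state_act \<phi>)) \<le> card (insert init X)"
    using fin sub by (rule surj_card_le)
  also have "\<dots> \<le> Suc (card X)"
    using X(1) by (simp add: card_insert_if)
  finally show "card (orbits states (state_act \<phi>)) \<le>
      Suc (8 * 2 ^ Suc width * 2 ^ (card (cl \<phi>) * (2 * width + 1) ^ width))"
    using X(2) by linarith
qed

subsection \<open>Transitions\<close>

lemma st_eq_Nil_iff: "st v e = st [] f \<longleftrightarrow> v = [] \<and> e = f"
  by (auto simp: st_eq_iff)

lemma aut_simps [simp]:
  "Qs aut = states" "pact aut = state_act \<phi>" "s0 aut = init"
  "st_supp aut q = supp (state_act \<phi>) q"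
  by (simp_all add: aut_def st_supp_def)

lemma init_in_states [simp]: "init \<in> states"
  by (simp add: states_def)

lemma st_in_states: "narrow (Suc width) v \<Longrightarrow> st v e \<in> states"
  unfolding states_def by blast

lemma fa_init [simp]: "fa aut init = Acc0"
  by (simp add: aut_def)

lemma fa_st: "fa aut (st v e) = (if v = [] then if e then AccTop else Acc1 else Acc0)"
  by (simp add: aut_def st_eq_Nil_iff)

lemma delta_cases:
  assumes "(p, l, q) \<in> delta aut"
  obtains (eps) v e where "p = init" "l = None" "q = st v e" "fn_str v = {}"
      "narrow (Suc width) v" "sat {} v \<phi>" "e \<longrightarrow> wide width v"
  | (letter) c v e where "p = st (c # v) e" "l = Some c" "q = st v e" "narrow (Suc width) (c # v)"
proof -
  have "(\<exists>v e. p = init \<and> l = None \<and> q = st v e \<and> fn_str v = {} \<and>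
      narrow (Suc width) v \<and> sat {} v \<phi> \<and> (e \<longrightarrow> wide width v)) \<or>
    (\<exists>c v e. p = st (c # v) e \<and> l = Some c \<and> q = st v e \<and> narrow (Suc width) (c # v))"
    using assms unfolding aut_def ernna.simps Un_iff mem_Collect_eq prod.inject by blast
  then show thesis
  proof (elim disjE exE conjE)
    fix v e assume "p = init" "l = None" "q = st v e" "fn_str v = {}"
      "narrow (Suc width) v" "sat {} v \<phi>" "e \<longrightarrow> wide width v"
    then show thesis by (rule eps)
  next
    fix c v e assume "p = st (c # v) e" "l = Some c" "q = st v e" "narrow (Suc width) (c # v)"
    then show thesis by (rule letter)
  qed
qed

lemma delta_epsI:
  "fn_str v = {} \<Longrightarrow> narrow (Suc width) v \<Longrightarrow> sat {} v \<phi> \<Longrightarrow> (e \<longrightarrow> wide width v) \<Longrightarrow>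
    (init, None, st v e) \<in> delta aut"
  unfolding aut_def ernna.simps by blast

lemma delta_letterI: "narrow (Suc width) (c # v) \<Longrightarrow> (st (c # v) e, Some c, st v e) \<in> delta aut"
  unfolding aut_def ernna.simps by blast

lemma delta_states:
  assumes "(p, l, q) \<in> delta aut"
  shows "p \<in> states \<and> q \<in> states"
  using assms by (cases rule: delta_cases) (simp_all add: st_in_states del: narrow.simps(2), simp add: st_in_states)

lemma delta_perm:
  assumes "(p, l, q) \<in> delta aut" "fperm \<pi>"
  shows "(state_act \<phi> \<pi> p, map_option (perm_bl \<pi>) l, state_act \<phi> \<pi> q) \<in> delta aut"
  using assms(1)
proof (cases rule: delta_cases)
  case (eps v e)
  \<comment> \<open>The formula stays fixed while the word is renamed, which is harmless because the
    guessed word has no free names.\<close>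
  have "sat {} (perm_str \<pi> v) \<phi> \<longleftrightarrow> sat {} (perm_str id v) \<phi>"
    by (rule sat_perm_cong) (use assms(2) eps(4) in simp_all)
  then have "sat {} (perm_str \<pi> v) \<phi>"
    using eps(6) by (simp only: perm_str_id)
  then have "(init, None, st (perm_str \<pi> v) e) \<in> delta aut"
    using eps assms(2) by (intro delta_epsI) (simp_all add: fn_str_perm fperm_inj narrow_perm wide_perm)
  then show ?thesis
    using eps(1-3) assms(2) by simp
next
  case (letter c v e)
  have "narrow (Suc width) (perm_str \<pi> (c # v))"
    using letter(4) by (simp only: narrow_perm[OF assms(2)])
  then have "(st (perm_bl \<pi> c # perm_str \<pi> v) e, Some (perm_bl \<pi> c), st (perm_str \<pi> v) e) \<in> delta aut"
    unfolding perm_str_simps by (rule delta_letterI)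
  then show ?thesis
    unfolding letter(1-3) act_st[OF assms(2)] option.map perm_str_simps .
qed

text \<open>Renaming the bound name in the target yields the tail of an alpha-variant of the same
  word, and alpha-variants represent the same source state.\<close>

lemma delta_Bar_alpha:
  assumes "(q, Some (Bar a), q') \<in> delta aut" "q'' \<in> states"
    and "abs_eq (state_act \<phi>) (supp (state_act \<phi>)) a q' b q''"
  shows "(q, Some (Bar b), q'') \<in> delta aut"
  using assms(1)
proof (cases rule: delta_cases)
  case (letter c v e)
  then have c: "c = Bar a" by simp
  have "q' \<in> states" using delta_states[OF assms(1)] by blast
  from assms(3)[unfolded abs_eq_iff[OF this assms(2)]]
  consider "a = b" "q' = q''" | "a \<noteq> b" "b \<notin> fn_str v" "q'' = st (perm_str (swp a b) v) e"
    unfolding letter(3) act_st[OF fperm_swp] supp_st by blast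
  then show ?thesis
  proof cases
    case 1
    then show ?thesis using assms(1) by simp
  next
    case 2
    let ?u = "perm_str (swp a b) v"
    have b: "b \<notin> fn_str (Bar a # v)" using 2(2) by simp
    have "narrow (Suc width) ?u"
      using letter(4) by (simp add: narrow_perm)
    then have "narrow (Suc width) (Bar b # ?u)"
      using letter(4) unfolding c narrow.simps fn_str_Bar_swp[OF b] by blast
    from delta_letterI[OF this, of e] show ?thesis
      unfolding st_Bar_swp[OF b] letter(1) c 2(3) .
  qed
qed simp

lemma finite_Plain_succs:
  assumes "q \<in> states"
  shows "finite {(a, q'). (q, Some (Plain a), q') \<in> delta aut}"
proof -
  let ?S = "supp (state_act \<phi>) q"
  have "{(a, q'). (q, Some (Plain a), q') \<in> delta aut} \<subseteq> ?S \<times> {st v e | v e. fn_str v \<subseteq> ?S}"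
  proof
    fix x assume "x \<in> {(a, q'). (q, Some (Plain a), q') \<in> delta aut}"
    then obtain a q' where x: "x = (a, q')" and "(q, Some (Plain a), q') \<in> delta aut"
      by blast
    from this(2) show "x \<in> ?S \<times> {st v e | v e. fn_str v \<subseteq> ?S}"
    proof (cases rule: delta_cases)
      case (letter c v e)
      then have "c = Plain a" by simp
      then have "?S = insert a (fn_str v)" using letter(1) by simp
      then show ?thesis unfolding x using letter(3) by blast
    qed simp
  qed
  moreover have "finite (?S \<times> {st v e | v e. fn_str v \<subseteq> ?S})"
    by (intro finite_cartesian_product finite_states_fn_str finite_sp assms)
  ultimately show ?thesis by (rule finite_subset)
qed

lemma finite_eps_succs: "finite {q'. (q, None, q') \<in> delta aut}"
proof (rule finite_subset)
  show "{q'. (q, None, q') \<in> delta aut} \<subseteq> {st v e | v e. fn_str v \<subseteq> {}}"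
  proof
    fix q' assume "q' \<in> {q'. (q, None, q') \<in> delta aut}"
    then have "(q, None, q') \<in> delta aut" by simp
    then show "q' \<in> {st v e | v e. fn_str v \<subseteq> {}}"
    proof (cases rule: delta_cases)
      case (eps v e)
      then show ?thesis by blast
    qed simp
  qed
qed (rule finite_states_fn_str, simp)

text \<open>All abstractions are represented with one name \<open>c\<close> fresh for
  \<open>q\<close>. Their targets then have free names in the support of \<open>q\<close> together
  with \<open>c\<close>, and there are finitely many such states.\<close>

lemma finite_Bar_succs:
  assumes "q \<in> states"
  shows "finite {{(b, q''). q'' \<in> states \<and> abs_eq (state_act \<phi>) (supp (state_act \<phi>)) a q' b q''} | a q'.
    (q, Some (Bar a), q') \<in> delta aut}"
proof -
  define C where
    "C a q' = {(b, q''). q'' \<in> states \<and> abs_eq (state_act \<phi>) (supp (state_act \<phi>)) a q' b q''}" for a q'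
  let ?S = "supp (state_act \<phi>) q"
  have "finite ?S" using assms by (rule finite_sp)
  then obtain c where c: "c \<notin> ?S" by (rule fresh_name)
  let ?X = "{st v e | v e. fn_str v \<subseteq> insert c ?S}"
  have C: "C a q' \<in> C c ` ?X" if \<delta>: "(q, Some (Bar a), q') \<in> delta aut" for a q'
    using \<delta>
  proof (cases rule: delta_cases)
    case (letter l v e)
    then have "l = Bar a" by simp
    then have S: "?S = fn_str v - {a}" using letter(1) by simp
    show ?thesis
    proof (cases "a = c")
      case True
      have "fn_str v \<subseteq> insert c ?S" unfolding S True by blast
      then have "q' \<in> ?X" unfolding letter(3) by blast
      then show ?thesis unfolding True by (rule imageI)
    next
      case False
      let ?q = "state_act \<phi> (swp a c) q'"
      have q': "q' \<in> states" using delta_states[OF \<delta>] by blast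
      have cv: "c \<notin> supp (state_act \<phi>) q'" using c False unfolding S letter(3) supp_st by blast
      have "q'' \<in> states \<and> abs_eq (state_act \<phi>) (supp (state_act \<phi>)) a q' b q'' \<longleftrightarrow>
          q'' \<in> states \<and> abs_eq (state_act \<phi>) (supp (state_act \<phi>)) c ?q b q''" for b q''
        using abs_eq_rename[OF q' _ not_sym[OF False] cv] by (rule conj_cong[OF refl])
      then have "C a q' = C c ?q"
        by (simp only: C_def)
      moreover have "fn_str (perm_str (swp a c) v) \<subseteq> insert c ?S"
        using c False unfolding S fn_str_perm[OF fperm_inj[OF fperm_swp]] by (auto simp: swp_def)
      then have "?q \<in> ?X"
        unfolding letter(3) act_st[OF fperm_swp] by blast
      ultimately show ?thesis by (rule image_eqI)
    qed
  qed simp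
  have "finite ?X"
    using \<open>finite ?S\<close> by (intro finite_states_fn_str) simp
  moreover have "{C a q' | a q'. (q, Some (Bar a), q') \<in> delta aut} \<subseteq> C c ` ?X"
  proof
    fix D assume "D \<in> {C a q' | a q'. (q, Some (Bar a), q') \<in> delta aut}"
    then obtain a q' where "D = C a q'" "(q, Some (Bar a), q') \<in> delta aut"
      by (elim CollectE exE conjE)
    then show "D \<in> C c ` ?X" by (simp only: C)
  qed
  ultimately have "finite {C a q' | a q'. (q, Some (Bar a), q') \<in> delta aut}"
    by (rule finite_surj)
  then show ?thesis by (simp only: C_def)
qed

lemma is_ernna_aut: "is_ernna aut"
  unfolding is_ernna_def
proof (intro conjI)
  show "nominal_set (Qs aut) (pact aut)"
    unfolding nominal_set_def aut_simps
  proof (intro conjI ballI allI impI)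
    fix q assume "q \<in> states"
    then show "\<exists>S. finite S \<and> supports (state_act \<phi>) S q"
    proof (rule states_cases)
      assume "q = init"
      then have "supports (state_act \<phi>) {} q" by (simp add: supports_def)
      then show ?thesis by blast
    next
      fix v e assume "q = st v e"
      then show ?thesis using supports_st finite_fn_str by blast
    qed
  qed (use act_id act_comp act_closed in auto)
  show "orbit_finite (Qs aut) (pact aut)"
    unfolding orbit_finite_def aut_simps by (rule card_orbits)
  show "delta aut \<subseteq> Qs aut \<times> UNIV \<times> Qs aut"
    using delta_states by auto
  show "\<forall>\<pi> q l q'. fperm \<pi> \<and> (q, l, q') \<in> delta aut \<longrightarrow>
      (pact aut \<pi> q, map_option (perm_bl \<pi>) l, pact aut \<pi> q') \<in> delta aut"
    unfolding aut_simps using delta_perm by blast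
  show "\<forall>\<pi> q. fperm \<pi> \<and> q \<in> Qs aut \<longrightarrow> fa aut (pact aut \<pi> q) = fa aut q"
    unfolding aut_simps
  proof (intro allI impI)
    fix \<pi> q assume *: "fperm \<pi> \<and> q \<in> states"
    then have "q \<in> states" ..
    then show "fa aut (state_act \<phi> \<pi> q) = fa aut q"
      by (rule states_cases) (use * in \<open>simp_all add: fa_st\<close>)
  qed
  show "\<forall>q a q' b q''. (q, Some (Bar a), q') \<in> delta aut \<and> q'' \<in> Qs aut \<and>
      abs_eq (pact aut) (st_supp aut) a q' b q'' \<longrightarrow> (q, Some (Bar b), q'') \<in> delta aut"
    unfolding aut_simps aut_simps(4)[abs_def] using delta_Bar_alpha by blast
  show "\<forall>q\<in>Qs aut. finite {(a, q'). (q, Some (Plain a), q') \<in> delta aut}"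
    unfolding aut_simps using finite_Plain_succs by blast
  show "\<forall>q\<in>Qs aut. finite {q'. (q, None, q') \<in> delta aut}"
    using finite_eps_succs by blast
  show "\<forall>q\<in>Qs aut. finite {{(b, q''). q'' \<in> Qs aut \<and> abs_eq (pact aut) (st_supp aut) a q' b q''} |a q'.
      (q, Some (Bar a), q') \<in> delta aut}"
    unfolding aut_simps aut_simps(4)[abs_def] using finite_Bar_succs by blast
  show "\<forall>q\<in>Qs aut. fa aut q = AccTop \<longrightarrow> st_supp aut q = {} \<and> (\<forall>l q'. (q, l, q') \<notin> delta aut)"
    unfolding aut_simps
  proof (intro ballI impI)
    fix q assume "q \<in> states" and top: "fa aut q = AccTop"
    from this(1) have q: "q = st [] True"
    proof (rule states_cases)
      fix v e assume "q = st v e"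
      then show ?thesis using top by (auto simp: fa_st split: if_splits)
    qed (use top in simp)
    have "(q, l, q') \<notin> delta aut" for l q'
    proof
      assume "(q, l, q') \<in> delta aut"
      then show False
      proof (cases rule: delta_cases)
        case (letter c v e)
        then have "st (c # v) e = st [] True" using q by simp
        then show False by (simp add: st_eq_Nil_iff)
      qed (simp add: q)
    qed
    then show "supp (state_act \<phi>) q = {} \<and> (\<forall>l q'. (q, l, q') \<notin> delta aut)"
      by (simp add: q)
  qed
qed simp_all

subsection \<open>The accepted language\<close>

lemma run_complete: "narrow (Suc width) w \<Longrightarrow> run aut (st w e) w (st [] e)"
proof (induction w)
  case Nil
  then show ?case by (intro run_nil) (simp add: st_in_states)
next
  case (Cons l w)
  have "run aut (st w e) w (st [] e)"
    using Cons by simp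
  with delta_letterI[OF Cons.prems] show ?case by (rule run_letter)
qed

text \<open>The equivalence of words is preserved by prepending letters, so a run ending in the class of
  the empty word can be traced back: every state on it is the class of the remaining input.\<close>

lemma run_sound:
  assumes "run aut p w q" "q = st [] e"
  shows "p = st w e \<or> p = init \<and> fn_str w = {} \<and> sat {} w \<phi> \<and> (e \<longrightarrow> wide width w)"
  using assms
proof (induction rule: run.induct)
  case (run_nil q)
  then show ?case by simp
next
  case (run_letter p \<sigma> p' w q)
  from run_letter.hyps(1) show ?case
  proof (cases rule: delta_cases)
    case (letter c v f)
    then have "st v f = st w e" using run_letter.IH run_letter.prems by simp
    then have "st (c # v) f = st (c # w) e" by (rule st_Cons)
    then show ?thesis using letter by simp
  qed simp
next
  case (run_eps p p' w q)
  from run_eps.hyps(1) show ?case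
  proof (cases rule: delta_cases)
    case (eps v f)
    then have "st v f = st w e" using run_eps.IH run_eps.prems by simp
    then have "fn_str v = fn_str w" "wide width v = wide width w" "f = e"
      "sat {} v \<phi> \<longleftrightarrow> sat {} w \<phi>"
      unfolding st_eq_iff using cl_perm_self by blast+
    then show ?thesis using eps by blast
  qed simp
qed

lemma fa_Acc1_iff: "fa aut q = Acc1 \<longleftrightarrow> q = st [] False"
  by (simp add: aut_def)

lemma fa_AccTop_iff: "fa aut q = AccTop \<longleftrightarrow> q = st [] True"
  by (simp add: aut_def st_eq_Nil_iff)

lemma L_pre_iff:
  "(w, Acc1) \<in> L_pre aut \<longleftrightarrow> run aut init w (st [] False)"
  "(w, AccTop) \<in> L_pre aut \<longleftrightarrow> run aut init w (st [] True)"
proof -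
  have "(w, x) \<in> L_pre aut \<longleftrightarrow> (\<exists>q. run aut init w q \<and> fa aut q = x) \<and> x \<in> {Acc1, AccTop}" for x
    unfolding L_pre_def aut_simps by blast
  then show "(w, Acc1) \<in> L_pre aut \<longleftrightarrow> run aut init w (st [] False)"
    "(w, AccTop) \<in> L_pre aut \<longleftrightarrow> run aut init w (st [] True)"
    by (simp_all add: fa_Acc1_iff fa_AccTop_iff)
qed

lemma run_init:
  assumes "fn_str w = {}" "narrow (Suc width) w" "sat {} w \<phi>" "e \<longrightarrow> wide width w"
  shows "run aut init w (st [] e)"
  using delta_epsI[OF assms] run_complete[OF assms(2)] by (rule run_eps)

text \<open>Narrow words are guessed in full. Any other word is cut after a prefix that is both
  narrow and wide; wideness allows its remainder to be exchanged for the empty word in one direction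
  and for an arbitrary one in the other.\<close>

lemma L_0_aut: "L_0 aut = {w. fn_str w = {} \<and> sat {} w \<phi>}"
proof (intro set_eqI iffI)
  fix w assume "w \<in> L_0 aut"
  then have fn: "fn_str w = {}"
    and "run aut init w (st [] False) \<or> (\<exists>v u. w = v @ u \<and> run aut init v (st [] True))"
    unfolding L_0_def ctx_strs_def Un_iff Int_iff mem_Collect_eq L_pre_iff by blast+
  from this(2) have "sat {} w \<phi>"
  proof (elim disjE exE conjE)
    assume "run aut init w (st [] False)"
    from run_sound[OF this refl] show ?thesis by simp
  next
    fix v u assume w: "w = v @ u" and "run aut init v (st [] True)"
    from run_sound[OF this(2) refl] have "sat {} (v @ []) \<phi>" "wide width v" by simp_all
    then show ?thesis
      unfolding w using cl_perm_self by (intro sat_wide_append_imp[of \<phi> v \<phi> "[]" u]) (simp_all add: width_def)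
  qed
  with fn show "w \<in> {w. fn_str w = {} \<and> sat {} w \<phi>}" by simp
next
  fix w assume "w \<in> {w. fn_str w = {} \<and> sat {} w \<phi>}"
  then have fn: "fn_str w = {}" and sat: "sat {} w \<phi>" by simp_all
  have "run aut init w (st [] False) \<or> (\<exists>v u. w = v @ u \<and> run aut init v (st [] True))"
  proof (cases "narrow (Suc width) w")
    case True
    then show ?thesis using run_init[OF fn True sat, of False] by simp
  next
    case False
    then obtain v u where w: "w = v @ u" and v: "narrow (Suc width) v" "wide width v"
      by (rule wide_narrow_prefix)
    have "fn_str v = {}" using fn fn_str_append_mono[of v u] unfolding w by blast
    moreover have "sat {} (v @ []) \<phi>"
      using v(2) sat cl_perm_self unfolding w by (intro sat_wide_append_imp[of \<phi> v \<phi> u "[]"]) (simp_all add: width_def)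
    ultimately have "run aut init v (st [] True)"
      using v by (intro run_init) simp_all
    then show ?thesis using w by blast
  qed
  then show "w \<in> L_0 aut"
    unfolding L_0_def ctx_strs_def Un_iff Int_iff mem_Collect_eq L_pre_iff using fn by blast
qed

lemma L_alpha_aut: "L_alpha aut = sem \<phi>"
proof -
  have "L_0 aut = {w. w \<in> ctx_strs {} \<and> sat {} w \<phi>}"
    unfolding L_0_aut ctx_strs_def by auto
  then show ?thesis unfolding L_alpha_def sem_def by (rule arg_cong)
qed

lemma degree_aut: "degree_le aut (Suc width)"
  unfolding degree_le_def aut_simps
proof
  fix q assume "q \<in> states"
  then show "card (supp (state_act \<phi>) q) \<le> Suc width"
    by (rule states_cases) (simp_all add: narrow_card)
qed

end

subsection \<open>Numeric bounds\<close>

lemma Suc_le_two_power: "Suc n \<le> 2 ^ n"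
  by (simp add: Suc_leI)

lemma power_double_le: "(2 * k + 1 :: nat) ^ k \<le> 2 ^ ((k + 1) ^ 4)"
proof -
  have "2 * k + 1 \<le> 2 ^ (k + 1)"
    using Suc_le_two_power[of k] by simp
  then have "(2 * k + 1) ^ k \<le> (2 ^ (k + 1)) ^ k"
    by (rule power_mono) simp
  also have "\<dots> = 2 ^ ((k + 1) * k)"
    by (simp only: power_mult)
  also have "\<dots> \<le> 2 ^ ((k + 1) ^ 4)"
  proof (rule power_increasing)
    have "(k + 1) * k \<le> (k + 1) ^ 2" by (simp add: power2_eq_square)
    also have "\<dots> \<le> (k + 1) ^ 4" by (rule power_increasing) simp_all
    finally show "(k + 1) * k \<le> (k + 1) ^ 4" .
  qed simp
  finally show ?thesis .
qed

lemma Suc_le_two_power4: "Suc k \<le> 2 ^ ((k + 1) ^ 4)"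
proof -
  have "Suc k \<le> 2 ^ k" by (rule Suc_le_two_power)
  also have "\<dots> \<le> 2 ^ ((k + 1) ^ 4)"
  proof (rule power_increasing)
    have "k \<le> (k + 1) ^ 1" by simp
    also have "\<dots> \<le> (k + 1) ^ 4" by (rule power_increasing) simp_all
    finally show "k \<le> (k + 1) ^ 4" .
  qed simp
  finally show ?thesis .
qed

text \<open>All factors are collected in one exponent of 2, with the leading \<open>Suc\<close>
  absorbed by a doubling. The powers of \<open>k\<close> go into the inner exponential and those of
  \<open>m\<close> stay polynomial.\<close>

lemma orbit_bound:
  assumes "1 \<le> m"
  shows "Suc (8 * 2 ^ Suc k * 2 ^ (m * (2 * k + 1) ^ k)) \<le> 2 ^ ((m + 1) ^ 4 * 2 ^ ((k + 1) ^ 4) :: nat)"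
proof -
  let ?P = "2 ^ ((k + 1) ^ 4) :: nat"
  let ?x = "2 ^ (4 + k + m * (2 * k + 1) ^ k) :: nat"
  have "8 * 2 ^ Suc k * 2 ^ (m * (2 * k + 1) ^ k) = ?x"
    by (simp add: power_add)
  moreover have "1 \<le> ?x" by simp
  ultimately have "Suc (8 * 2 ^ Suc k * 2 ^ (m * (2 * k + 1) ^ k)) \<le> 2 * ?x"
    by linarith
  also have "\<dots> = 2 ^ (4 + Suc k + m * (2 * k + 1) ^ k)"
    by (simp only: power_Suc add_Suc_right add_Suc)
  also have "\<dots> \<le> 2 ^ ((m + 1) ^ 4 * ?P)"
  proof (rule power_increasing)
    have "m * (2 * k + 1) ^ k \<le> m * ?P"
      using power_double_le by (rule mult_le_mono2)
    moreover have "Suc k \<le> ?P" "1 \<le> ?P"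
      by (rule Suc_le_two_power4) simp
    \<comment> \<open>Each summand is a multiple of \<open>?P\<close>: the constant costs 4 copies,
      \<open>Suc k\<close> one and the last term \<open>m\<close>.\<close>
    ultimately have "4 + Suc k + m * (2 * k + 1) ^ k \<le> (m + 5) * ?P"
      unfolding add_mult_distrib by linarith
    also have "\<dots> \<le> (m + 1) ^ 4 * ?P"
    proof (rule mult_le_mono1)
      have "(2 :: nat) ^ 3 \<le> (m + 1) ^ 3"
        using assms by (intro power_mono) simp_all
      then have 8: "8 * (m + 1) \<le> (m + 1) ^ 3 * (m + 1)"
        by (intro mult_le_mono1) simp
      have "m + 5 \<le> 8 * (m + 1)" by simp
      also have "\<dots> \<le> (m + 1) ^ 3 * (m + 1)" by (rule 8)
      also have "\<dots> = (m + 1) ^ 4"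
        by (simp only: power4_eq_xxxx power3_eq_cube)
      finally show "m + 5 \<le> (m + 1) ^ 4" .
    qed
    finally show "4 + Suc k + m * (2 * k + 1) ^ k \<le> (m + 1) ^ 4 * ?P" .
  qed simp
  finally show ?thesis .
qed

theorem theorem6p5:
  shows "\<exists>c::nat. \<forall>\<phi>::fml.
     bar_formula \<phi> \<and> closed_fml \<phi> \<and> fn_fml \<phi> = {} \<longrightarrow>
     (\<exists>A :: nat ernna.
        is_ernna A
      \<and> degree_le A ((size_fml \<phi> + 1) ^ c * 2 ^ ((degree_fml \<phi> + 1) ^ c))
      \<and> num_orbits A \<le> 2 ^ ((size_fml \<phi> + 1) ^ c * 2 ^ ((degree_fml \<phi> + 1) ^ c))
      \<and> L_alpha A = sem \<phi>)"
\<comment> \<open>One exponent serves both bounds: 4 covers \<open>m + 5\<close> for positive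
  \<open>m\<close> as well as the exponent \<open>(k + 1) * k\<close> from the renamings.\<close>
proof (rule exI[of _ 4], intro allI impI)
  fix \<phi> assume "bar_formula \<phi> \<and> closed_fml \<phi> \<and> fn_fml \<phi> = {}"
  then interpret formula_automaton \<phi>
    by unfold_locales simp
  have k: "degree_fml \<phi> = width"
    by (simp add: degree_fml_def width_def names_fml_fn_bn)
  have "0 < card (cl \<phi>)"
    using finite_cl[OF closed] cl.self[of \<phi>] by (simp only: card_gt_0_iff) blast
  then have m: "1 \<le> size_fml \<phi>"
    by (simp add: size_fml_def)
  have "Suc width \<le> 2 ^ ((width + 1) ^ 4)"
    by (rule Suc_le_two_power4)
  \<comment> \<open>The degree actually achieved is only \<open>width + 1\<close>, far below the
    permitted bound.\<close>
  also have "\<dots> \<le> (size_fml \<phi> + 1) ^ 4 * 2 ^ ((width + 1) ^ 4)"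
    by simp
  finally have "degree_le aut ((size_fml \<phi> + 1) ^ 4 * 2 ^ ((degree_fml \<phi> + 1) ^ 4))"
    using degree_aut unfolding degree_le_def k by (meson order_trans)
  moreover have "num_orbits aut \<le> 2 ^ ((size_fml \<phi> + 1) ^ 4 * 2 ^ ((degree_fml \<phi> + 1) ^ 4))"
    using order_trans[OF card_orbits(2) orbit_bound[OF m, of width, unfolded size_fml_def]]
    unfolding num_orbits_def aut_simps k size_fml_def .
  ultimately show "\<exists>A :: nat ernna. is_ernna A
      \<and> degree_le A ((size_fml \<phi> + 1) ^ 4 * 2 ^ ((degree_fml \<phi> + 1) ^ 4))
      \<and> num_orbits A \<le> 2 ^ ((size_fml \<phi> + 1) ^ 4 * 2 ^ ((degree_fml \<phi> + 1) ^ 4))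
      \<and> L_alpha A = sem \<phi>"
    using is_ernna_aut L_alpha_aut by blast
qed

end
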